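(* Let $v\ge 3$ and let $L(Cycle(v))$ be the Laplacian matrix of the cycle on $v$ vertices. For every integer $y\ge 0$, any design with Laplacian matrix $L(Cycle(v))[y]$ is $D$-optimal, and for every integer $y\ge 1$ any such design is $A$-optimal, among connected designs with Laplacian matrix $L[y]$ with $L\in\mathcal{L}_1(v,v,2)$. That is, for every $L\in\mathcal{L}_1(v,v,2)$ one has $D(y,L(Cycle(v)))\ge D(y,L)$ for $y\ge 0$ and $A(y,L(Cycle(v)))\ge A(y,L)$ for $y\ge 1$.
   Context: A binary block design with $v$ treatments and $b$ blocks of size $2$ is the same thing as a loopless multigraph with $v$ vertices (treatments) and $b$ edges (blocks); its Laplacian matrix is the graph Laplacian $\mathrm{diag}(\delta_1,\dots,\delta_v)-A$, where $A$ is the adjacency matrix (entry $ij$ = number of edges joining $i$ and $j$) and $\delta_i$ are the vertex degrees counted with multiplicity. All designs considered here are assumed connected. Thus $\mathcal{L}_1(v,v,2)$ is the set of Laplacian matrices of connected loopless multigraphs with $v$ vertices and $v$ edges. $Cycle(v)$ is the graph with vertices $w_1,\dots,w_v$ and one edge joining $w_i$ and $w_{i+1}$ for each $i=1,\dots,v$, where $w_{v+1}=w_1$. For a Laplacian matrix $L$, let $\rho^L_1,\dots,\rho^L_{v-1}$ be its eigenvalues with multiplicity other than one copy of the eigenvalue $0$ of the all-ones vector. For an integer $y\ge0$, $L[y]=L+y(vI_v-J_v)$ ($I_v$ identity, $J_v$ all-ones matrix), the Laplacian of the design obtained by adding $y$ copies of every pair of treatments as blocks. Put $$A(y,L)=\frac{v-1}{\sum_{i=1}^{v-1}\frac{1}{vy+\rho_i^L}},\qquad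 D(y,L)=\prod_{i=1}^{v-1}(vy+\rho_i^L).$$ $A$-optimal ($D$-optimal) means having the maximal value of $A(y,\cdot)$ ($D(y,\cdot)$) in the class considered. *)

theory Defs
  imports
    "HOL-Library.Multiset"
    "HOL-Computational_Algebra.Computational_Algebra"
    "Jordan_Normal_Form.Char_Poly"
begin

text \<open>
  A binary block design with treatments \<open>{..<v}\<close> and blocks of size 2 (equivalently a loopless
  multigraph) is represented by the multiset of its blocks; the number of blocks is its size.
\<close>

definition binary_design :: "nat \<Rightarrow> nat set multiset \<Rightarrow> bool" where
  "binary_design v E \<longleftrightarrow> (\<forall>e\<in>#E. e \<subseteq> {..<v} \<and> card e = 2)"

definition connected_design :: "nat \<Rightarrow> nat set multiset \<Rightarrow> bool" where
  "connected_design v E \<longleftrightarrow> binary_design v E \<and>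
     (\<forall>i<v. \<forall>j<v. (i, j) \<in> {(a, b). {a, b} \<in># E}\<^sup>*)"

definition degree_in :: "nat set multiset \<Rightarrow> nat \<Rightarrow> nat" where
  "degree_in E i = size {# e \<in># E. i \<in> e #}"

text \<open>For \<open>i = j\<close> the set \<open>{i, j}\<close> is a singleton, so the diagonal vanishes for binary designs.\<close>

definition adjacency :: "nat \<Rightarrow> nat set multiset \<Rightarrow> real mat" where
  "adjacency v E = mat v v (\<lambda>(i, j). real (count E {i, j}))"

definition laplacian :: "nat \<Rightarrow> nat set multiset \<Rightarrow> real mat" where
  "laplacian v E = mat_diag v (\<lambda>i. real (degree_in E i)) - adjacency v E"

text \<open>\<open>laplacians v b\<close> is the class $\mathcal{L}_1(v,b,2)$.\<close>

definition laplacians :: "nat \<Rightarrow> nat \<Rightarrow> real mat set" where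
  "laplacians v b = {laplacian v E | E. connected_design v E \<and> size E = b}"

definition Cycle :: "nat \<Rightarrow> nat set multiset" where
  "Cycle v = image_mset (\<lambda>i. {i, Suc i mod v}) (mset_set {..<v})"

text \<open>\<open>augment v y L\<close> is $L[y]$.\<close>

definition augment :: "nat \<Rightarrow> nat \<Rightarrow> real mat \<Rightarrow> real mat" where
  "augment v y L = L + real y \<cdot>\<^sub>m (real v \<cdot>\<^sub>m 1\<^sub>m v - mat v v (\<lambda>_. 1))"

text \<open>
  The eigenvalues $\rho^L_1,\dots,\rho^L_{v-1}$. Laplacians are real symmetric, so the
  characteristic polynomial splits over the reals and its roots, counted with multiplicity, are
  all \<open>v\<close> eigenvalues.
\<close>

definition nontrivial_eigenvalues :: "real mat \<Rightarrow> real multiset" where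
  "nontrivial_eigenvalues L = proots (char_poly L) - {#0#}"

definition A_value :: "nat \<Rightarrow> nat \<Rightarrow> real mat \<Rightarrow> real" where
  "A_value v y L =
     (real v - 1) / (\<Sum>\<rho>\<in>#nontrivial_eigenvalues L. 1 / (real v * real y + \<rho>))"

definition D_value :: "nat \<Rightarrow> nat \<Rightarrow> real mat \<Rightarrow> real" where
  "D_value v y L = (\<Prod>\<rho>\<in>#nontrivial_eigenvalues L. real v * real y + \<rho>)"

text \<open>
  Optimality of a design \<open>E\<close> among the connected designs with Laplacian $L[y]$ for some \<open>L\<close> in
  \<open>laplacians v b\<close>. The criterion \<open>\<Phi>\<close> is evaluated at \<open>L\<close>, which is determined by $L[y]$.
\<close>

definition optimal_among ::
  "(nat \<Rightarrow> nat \<Rightarrow> real mat \<Rightarrow> real) \<Rightarrow> nat \<Rightarrow> nat \<Rightarrow> nat \<Rightarrow> nat set multiset \<Rightarrow> bool" where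
  "optimal_among \<Phi> v b y E \<longleftrightarrow> connected_design v E \<and>
     (\<exists>L\<in>laplacians v b. laplacian v E = augment v y L \<and>
        (\<forall>E'. \<forall>L'\<in>laplacians v b.
            connected_design v E' \<and> laplacian v E' = augment v y L' \<longrightarrow> \<Phi> v y L' \<le> \<Phi> v y L))"

definition D_optimal :: "nat \<Rightarrow> nat \<Rightarrow> nat \<Rightarrow> nat set multiset \<Rightarrow> bool" where
  "D_optimal = optimal_among D_value"

definition A_optimal :: "nat \<Rightarrow> nat \<Rightarrow> nat \<Rightarrow> nat set multiset \<Rightarrow> bool" where
  "A_optimal = optimal_among A_value"

end

theory Submission
  imports Defs
    "HOL-Analysis.Convex"
    "HOL-Real_Asymp.Real_Asymp"
    "Jordan_Normal_Form.Schur_Decomposition"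
    "Jordan_Normal_Form.Jordan_Normal_Form_Uniqueness"
begin

text \<open>
  Let \<open>x = v y\<close>, \<open>a = x + 2\<close> and shift the eigenvalues to \<open>t = \<rho> - 2\<close>. For \<open>y \<ge> 1\<close> the sum of
  \<open>1 / (a + t)\<close> is compared with its third Taylor polynomial at \<open>t = 0\<close>: the polynomial is a lower
  bound for every graph, and for the cycle, where \<open>\<bar>t\<bar> \<le> 2\<close>, an interpolating cubic is an upper bound.
  The power sums of \<open>t\<close> up to order three are traces, hence expressions in the degrees
  and edge multiplicities. A connected graph with \<open>v\<close> vertices and \<open>v\<close> edges is either simple or has
  exactly one double edge, and the resulting gap is large enough unless the graph is simple and
  2-regular, in which case it is the cycle. This gives A-optimality, for every real \<open>x \<ge> v\<close>. The
  logarithmic derivative in \<open>x\<close> of the product of the \<open>x + \<rho>\<close> is the sum of the \<open>1 / (x + \<rho>)\<close>, so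
  integrating from \<open>x\<close> to infinity gives D-optimality for \<open>y \<ge> 1\<close>.

  For \<open>y = 0\<close>, write \<open>L = N N\<^sup>T\<close> with the square incidence matrix \<open>N\<close> and let \<open>z\<close> be a unit vector in
  the kernel of \<open>N\<close>. The product of the nontrivial eigenvalues is \<open>v det(M)\<^sup>2\<close>, where \<open>M\<close> is \<open>N\<close> with
  one row replaced by \<open>z\<close>. Since \<open>N\<close> is totally unimodular, the Cauchy-Schwarz inequality gives
  \<open>det(M)\<^sup>2 \<le> v\<close>, with equality for the cycle.
\<close>

no_notation fps_nth (infixl "$" 75)

section \<open>Power sums of eigenvalues\<close>

definition mat_trace :: "'a::comm_ring_1 mat \<Rightarrow> 'a" where
  "mat_trace A = (\<Sum>i<dim_row A. A $$ (i, i))"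

lemma index_mult_mat_sum:
  assumes "A \<in> carrier_mat n m" "B \<in> carrier_mat m k" "i < n" "j < k"
  shows "(A * B) $$ (i, j) = (\<Sum>l<m. A $$ (i, l) * B $$ (l, j))"
  using assms by (auto simp: scalar_prod_def lessThan_atLeast0)

lemma mat_trace_comm:
  assumes "A \<in> carrier_mat n n" "B \<in> carrier_mat n n"
  shows "mat_trace (A * B) = mat_trace (B * A)"
proof -
  have "mat_trace (A * B) = (\<Sum>i<n. \<Sum>l<n. A $$ (i, l) * B $$ (l, i))"
    using assms unfolding mat_trace_def by (auto simp: index_mult_mat_sum intro!: sum.cong simp del: index_mult_mat(1))
  also have "\<dots> = (\<Sum>l<n. \<Sum>i<n. A $$ (i, l) * B $$ (l, i))"
    by (rule sum.swap)
  also have "\<dots> = mat_trace (B * A)"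
    using assms unfolding mat_trace_def by (auto simp: index_mult_mat_sum mult.commute intro!: sum.cong simp del: index_mult_mat(1))
  finally show ?thesis .
qed

lemma mat_trace_similar:
  assumes "similar_mat_wit A B P Q" "A \<in> carrier_mat n n"
  shows "mat_trace A = mat_trace B"
proof -
  note w = similar_mat_witD2[OF assms(2,1)]
  have "mat_trace A = mat_trace (P * (B * Q))" using w by simp
  also have "\<dots> = mat_trace ((B * Q) * P)" using w by (intro mat_trace_comm) auto
  also have "(B * Q) * P = B" using w by simp
  finally show ?thesis .
qed

lemma upper_triangular_times:
  assumes "A \<in> carrier_mat n n" "B \<in> carrier_mat n n" "upper_triangular A" "upper_triangular B"
  shows "upper_triangular (A * B)" "i < n \<Longrightarrow> (A * B) $$ (i, i) = A $$ (i, i) * B $$ (i, i)"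
proof -
  have z: "A $$ (i, l) * B $$ (l, j) = 0" if "i < n" "l < n" "j < i \<or> (j = i \<and> l \<noteq> i)" for i j l
    using that assms upper_triangularD[of A l i] upper_triangularD[of B j l]
    by (cases "l < i") auto
  show "upper_triangular (A * B)"
  proof (rule upper_triangularI)
    fix i j assume "j < i" "i < dim_row (A * B)"
    then show "(A * B) $$ (i, j) = 0"
      using assms by (subst index_mult_mat_sum[OF assms(1,2)]) (auto intro!: sum.neutral z)
  qed
  show "(A * B) $$ (i, i) = A $$ (i, i) * B $$ (i, i)" if "i < n"
  proof -
    have "(A * B) $$ (i, i) = (\<Sum>l<n. A $$ (i, l) * B $$ (l, i))"
      using that by (rule index_mult_mat_sum[OF assms(1,2)]) (use that in simp)
    also have "\<dots> = (\<Sum>l\<in>{i}. A $$ (i, l) * B $$ (l, i))"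
      using that by (intro sum.mono_neutral_right) (auto intro!: z)
    finally show ?thesis by simp
  qed
qed

lemma upper_triangular_pow:
  fixes A :: "'a::comm_ring_1 mat"
  assumes "A \<in> carrier_mat n n" "upper_triangular A"
  shows "upper_triangular (A ^\<^sub>m k) \<and> (\<forall>i<n. (A ^\<^sub>m k) $$ (i, i) = (A $$ (i, i)) ^ k)"
proof (induction k)
  case (Suc k)
  have "A ^\<^sub>m k \<in> carrier_mat n n" using assms by simp
  from upper_triangular_times[OF this assms(1) _ assms(2)] Suc show ?case by (auto simp: mult.commute simp del: index_mult_mat(1))
qed (use assms in auto)

text \<open>A Schur decomposition makes the matrix triangular with diagonal \<open>es\<close>.
  Subtracting \<open>c\<close> times the identity and taking powers preserves both the similarity
  and the triangular shape, so the trace can be read off the diagonal.\<close>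

lemma trace_char_matrix_pow:
  fixes A :: "'a::conjugatable_ordered_field mat"
  assumes A: "A \<in> carrier_mat n n" and cp: "char_poly A = (\<Prod>e\<leftarrow>es. [:- e, 1:])"
  shows "mat_trace (char_matrix A c ^\<^sub>m k) = (\<Sum>e\<leftarrow>es. (e - c) ^ k)"
proof -
  obtain B P Q where s: "schur_decomposition A es = (B, P, Q)" by (cases "schur_decomposition A es")
  note * = schur_decomposition[OF A cp s]
  then have w: "similar_mat_wit A B P Q" and ut: "upper_triangular B" and d: "diag_mat B = es" by auto
  have B: "B \<in> carrier_mat n n" using similar_mat_witD2[OF A w] by auto
  let ?B = "char_matrix B c"
  have cB: "?B \<in> carrier_mat n n" using B by simp
  have u: "upper_triangular ?B" using ut B by (auto simp: char_matrix_def upper_triangular_def)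
  have len: "length es = n" using d B by (auto simp: diag_mat_def)
  have "mat_trace (char_matrix A c ^\<^sub>m k) = mat_trace (?B ^\<^sub>m k)"
    by (rule mat_trace_similar[OF similar_mat_wit_pow[OF similar_mat_wit_char_matrix[OF w]], where n=n]) (use A in simp)
  also have "\<dots> = (\<Sum>i<n. (B $$ (i, i) - c) ^ k)"
    unfolding mat_trace_def using upper_triangular_pow[OF cB u, of k] B
    by (auto simp: char_matrix_def intro!: sum.cong)
  also have "\<dots> = (\<Sum>i<n. (es ! i - c) ^ k)"
    unfolding d[symmetric] using B by (auto simp: diag_mat_def intro!: sum.cong)
  also have "\<dots> = (\<Sum>e\<leftarrow>es. (e - c) ^ k)"
    by (simp add: sum_list_sum_nth len lessThan_atLeast0)
  finally show ?thesis .
qed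

text \<open>The characteristic polynomial splits over the complex numbers. For an eigenvector
  \<open>u\<close> with eigenvalue \<open>a\<close>, symmetry makes the form u* A u = a |u|^2 equal
  to its own conjugate, so \<open>a\<close> is real. The factorisation then descends to the reals
  because the embedding of coefficients is injective.\<close>

lemma real_symmetric_char_poly_splits:
  fixes A :: "real mat"
  assumes A: "A \<in> carrier_mat n n" and sym: "\<And>i j. i < n \<Longrightarrow> j < n \<Longrightarrow> A $$ (i, j) = A $$ (j, i)"
  shows "\<exists>es. char_poly A = (\<Prod>e\<leftarrow>es. [:- e, 1:]) \<and> length es = n"
proof -
  let ?A = "map_mat complex_of_real A"
  have cA: "?A \<in> carrier_mat n n" using A by simp
  obtain as where as: "char_poly ?A = (\<Prod>a\<leftarrow>as. [:- a, 1:])" "length as = n"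
    using char_poly_factorized[OF cA] by auto
  have real: "a \<in> \<real>" if "a \<in> set as" for a
  proof -
    have "poly (char_poly ?A) a = 0" unfolding as(1) using that
      by (induction as) auto
    then have "eigenvalue ?A a" using eigenvalue_root_char_poly[OF cA] by simp
    then obtain u where u: "u \<in> carrier_vec n" "u \<noteq> 0\<^sub>v n" "?A *\<^sub>v u = a \<cdot>\<^sub>v u"
      unfolding eigenvalue_def eigenvector_def using A by auto
    have row: "(\<Sum>j<n. of_real (A $$ (i, j)) * u $ j) = a * u $ i" if "i < n" for i
    proof -
      have "(?A *\<^sub>v u) $ i = (\<Sum>j<n. of_real (A $$ (i, j)) * u $ j)"
        using that A u(1) by (auto simp: scalar_prod_def lessThan_atLeast0)
      then show ?thesis unfolding u(3) using that u(1) by simp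
    qed
    define s where "s = (\<Sum>i<n. cnj (u $ i) * u $ i)"
    have s: "s = of_real (\<Sum>i<n. (cmod (u $ i))\<^sup>2)"
      unfolding s_def of_real_sum by (intro sum.cong refl) (metis complex_norm_square mult.commute)
    have s0: "s \<noteq> 0"
    proof
      assume "s = 0"
      then have "(\<Sum>i<n. (cmod (u $ i))\<^sup>2) = 0" unfolding s of_real_eq_0_iff .
      then have "\<forall>i<n. u $ i = 0" by (subst (asm) sum_nonneg_eq_0_iff) auto
      with u show False by (auto simp: vec_eq_iff)
    qed
    have q: "(\<Sum>i<n. cnj (u $ i) * (\<Sum>j<n. of_real (A $$ (i, j)) * u $ j)) = a * s"
      unfolding s_def sum_distrib_left by (intro sum.cong refl) (simp add: row sum_distrib_left[symmetric] mult.left_commute)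
    have "cnj (a * s) = (\<Sum>i<n. \<Sum>j<n. u $ i * of_real (A $$ (i, j)) * cnj (u $ j))"
      unfolding q[symmetric] by (simp add: sum_distrib_left mult.assoc)
    also have "\<dots> = (\<Sum>j<n. \<Sum>i<n. u $ i * of_real (A $$ (i, j)) * cnj (u $ j))"
      by (rule sum.swap)
    also have "\<dots> = a * s"
      unfolding q[symmetric] sum_distrib_left by (intro sum.cong refl) (auto simp: sym)
    finally have "cnj a * s = a * s" by (simp add: s)
    then show "a \<in> \<real>" using s0 by (simp add: Reals_cnj_iff)
  qed
  interpret h: map_poly_inj_idom_hom "of_real :: real \<Rightarrow> complex" ..
  define es where "es = map Re as"
  have as_es: "as = map complex_of_real es"
    unfolding es_def using real by (auto intro!: nth_equalityI simp: comp_def)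
  have "map_poly complex_of_real (char_poly A) = char_poly ?A"
    by (rule of_real_hom.char_poly_hom[OF A, symmetric])
  also have "\<dots> = map_poly complex_of_real (\<Prod>e\<leftarrow>es. [:- e, 1:])"
    unfolding as(1) as_es by (induction es) (simp_all only: h.hom_mult hom_distribs list.map prod_list.Cons prod_list.Nil h.hom_one, simp_all)
  finally have "char_poly A = (\<Prod>e\<leftarrow>es. [:- e, 1:])"
    by (simp add: poly_eq_iff)
  moreover have "length es = n" using as(2) by (simp add: es_def)
  ultimately show ?thesis by blast
qed

section \<open>Spectra of weighted Laplacians\<close>

lemma proots_prod_linear: "proots (\<Prod>e\<leftarrow>es. [:- e, 1:]) = mset (es :: 'a::idom list)"
proof (induction es)
  case (Cons a es)
  have "(\<Prod>e\<leftarrow>es. [:- e, 1:]) \<noteq> 0" by (auto simp: prod_list_zero_iff)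
  then have "proots ([:- a, 1:] * (\<Prod>e\<leftarrow>es. [:- e, 1:])) = proots [:- a, 1:] + proots (\<Prod>e\<leftarrow>es. [:- e, 1:])"
    by (intro proots_mult) auto
  with Cons show ?case by (simp del: mult_pCons_left)
qed simp

lemma eigenvector_function:
  fixes A :: "real mat"
  assumes A: "A \<in> carrier_mat n n" and "char_poly A = (\<Prod>e\<leftarrow>es. [:- e, 1:])" "e \<in> set es"
  obtains u where "\<And>i. i < n \<Longrightarrow> (\<Sum>j<n. A $$ (i, j) * u j) = e * u i" "(\<Sum>i<n. (u i)\<^sup>2) > 0"
proof -
  have "poly (char_poly A) e = 0" unfolding assms(2) using assms(3) by (induction es) auto
  then obtain u where u: "u \<in> carrier_vec n" "u \<noteq> 0\<^sub>v n" "A *\<^sub>v u = e \<cdot>\<^sub>v u"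
    using eigenvalue_root_char_poly[OF A] A unfolding eigenvalue_def eigenvector_def by auto
  have "(\<Sum>j<n. A $$ (i, j) * u $ j) = e * u $ i" if "i < n" for i
  proof -
    have "(A *\<^sub>v u) $ i = (\<Sum>j<n. A $$ (i, j) * u $ j)"
      using that A u(1) by (auto simp: scalar_prod_def lessThan_atLeast0)
    then show ?thesis unfolding u(3) using that u(1) by simp
  qed
  moreover have "(\<Sum>i<n. (u $ i)\<^sup>2) > 0"
  proof -
    obtain i where "i < n" "u $ i \<noteq> 0" using u by (auto simp: vec_eq_iff)
    then show ?thesis by (intro sum_pos2[of _ i]) auto
  qed
  ultimately show ?thesis by (rule that)
qed

text \<open>The row sum of row \<open>i\<close> is \<open>w i i\<close>, so this is a Laplacian in
  the usual sense for weights that vanish on the diagonal.\<close>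

definition weighted_laplacian :: "nat \<Rightarrow> (nat \<Rightarrow> nat \<Rightarrow> real) \<Rightarrow> real mat" where
  "weighted_laplacian n w = mat n n (\<lambda>(i, j). if i = j then (\<Sum>k<n. w i k) else - w i j)"

lemma weighted_laplacian_carrier [simp]: "weighted_laplacian n w \<in> carrier_mat n n"
  by (simp add: weighted_laplacian_def)

lemma weighted_laplacian_char_poly_splits:
  assumes "\<And>i j. w i j = w j i"
  obtains es where "char_poly (weighted_laplacian n w) = (\<Prod>e\<leftarrow>es. [:- e, 1:])" "length es = n"
proof -
  have "\<exists>es. char_poly (weighted_laplacian n w) = (\<Prod>e\<leftarrow>es. [:- e, 1:]) \<and> length es = n"
    using assms by (intro real_symmetric_char_poly_splits) (auto simp: weighted_laplacian_def)
  then show ?thesis using that by blast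
qed

text \<open>This is the Dirichlet form. Exchanging the two indices symmetrises the double sum, and
  each unordered pair is then counted twice, whence the factor 1/2.\<close>

lemma weighted_laplacian_quadratic:
  assumes sym: "\<And>i j. w i j = w j i" and diag: "\<And>i. w i i = 0"
  shows "(\<Sum>i<n. u i * (\<Sum>j<n. weighted_laplacian n w $$ (i, j) * u j)) =
         (\<Sum>i<n. \<Sum>j<n. w i j * (u i - u j)\<^sup>2) / 2"
proof -
  have row: "u i * (\<Sum>j<n. weighted_laplacian n w $$ (i, j) * u j) = (\<Sum>j<n. w i j * (u i * (u i - u j)))"
    if "i < n" for i
  proof -
    have "(\<Sum>j<n. weighted_laplacian n w $$ (i, j) * u j)
      = (\<Sum>j<n. (if i = j then (\<Sum>k<n. w i k) * u j else 0) - w i j * u j)"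
      using that by (intro sum.cong) (auto simp: weighted_laplacian_def diag)
    also have "\<dots> = (\<Sum>k<n. w i k) * u i - (\<Sum>j<n. w i j * u j)"
      using that by (simp add: sum_subtractf)
    also have "\<dots> = (\<Sum>j<n. w i j * (u i - u j))"
      by (simp add: sum_distrib_right right_diff_distrib sum_subtractf)
    finally show ?thesis by (simp add: sum_distrib_left mult_ac)
  qed
  let ?S = "\<Sum>i<n. \<Sum>j<n. w i j * (u i * (u i - u j))"
  have "?S = (\<Sum>i<n. \<Sum>j<n. w i j * (u j * (u j - u i)))"
    by (subst sum.swap) (simp add: sym)
  then have "?S + ?S = (\<Sum>i<n. \<Sum>j<n. w i j * (u i * (u i - u j)) + w i j * (u j * (u j - u i)))"
    by (simp add: sum.distrib)
  also have "\<dots> = (\<Sum>i<n. \<Sum>j<n. w i j * (u i - u j)\<^sup>2)"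
    by (intro sum.cong refl) (simp add: power2_eq_square algebra_simps)
  finally show ?thesis using row by simp
qed

text \<open>Both bounds come from the Dirichlet form at an eigenvector: it is nonnegative, and (u i
  - u j)^2 is at most 2 (u i)^2 + 2 (u j)^2. For the cycle, \<open>d = 2\<close> confines the
  spectrum to [0, 4].\<close>

lemma weighted_laplacian_eigenvalue_bounds:
  assumes sym: "\<And>i j. w i j = w j i" and diag: "\<And>i. w i i = 0" and nn: "\<And>i j. w i j \<ge> 0"
    and cp: "char_poly (weighted_laplacian n w) = (\<Prod>e\<leftarrow>es. [:- e, 1:])" and e: "e \<in> set es"
  shows "0 \<le> e" "(\<And>i. i < n \<Longrightarrow> (\<Sum>j<n. w i j) \<le> d) \<Longrightarrow> e \<le> 2 * d"
proof -
  obtain u where u: "\<And>i. i < n \<Longrightarrow> (\<Sum>j<n. weighted_laplacian n w $$ (i, j) * u j) = e * u i"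
      "(\<Sum>i<n. (u i)\<^sup>2) > 0"
    by (rule eigenvector_function[OF weighted_laplacian_carrier cp e]) blast
  have eq: "e * (\<Sum>i<n. (u i)\<^sup>2) = (\<Sum>i<n. \<Sum>j<n. w i j * (u i - u j)\<^sup>2) / 2"
    unfolding weighted_laplacian_quadratic[OF sym diag, symmetric] sum_distrib_left[of e]
    by (intro sum.cong refl) (simp add: u power2_eq_square)
  have "e * (\<Sum>i<n. (u i)\<^sup>2) \<ge> 0" unfolding eq by (intro divide_nonneg_pos sum_nonneg) (auto simp: nn)
  with u(2) show "0 \<le> e" by (simp add: zero_le_mult_iff)
  assume d: "\<And>i. i < n \<Longrightarrow> (\<Sum>j<n. w i j) \<le> d"
  have "(\<Sum>i<n. \<Sum>j<n. w i j * (u i - u j)\<^sup>2) \<le> (\<Sum>i<n. \<Sum>j<n. w i j * (2 * (u i)\<^sup>2 + 2 * (u j)\<^sup>2))"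
  proof (intro sum_mono mult_left_mono nn)
    fix i j
    have "0 \<le> (u i + u j)\<^sup>2" by simp
    then show "(u i - u j)\<^sup>2 \<le> 2 * (u i)\<^sup>2 + 2 * (u j)\<^sup>2" by (simp add: power2_eq_square algebra_simps)
  qed
  also have "\<dots> = (\<Sum>i<n. \<Sum>j<n. w i j * (2 * (u i)\<^sup>2)) + (\<Sum>i<n. \<Sum>j<n. w i j * (2 * (u j)\<^sup>2))"
    by (simp add: distrib_left sum.distrib)
  also have "(\<Sum>i<n. \<Sum>j<n. w i j * (2 * (u j)\<^sup>2)) = (\<Sum>i<n. \<Sum>j<n. w i j * (2 * (u i)\<^sup>2))"
    by (subst sum.swap) (simp add: sym)
  also have "(\<Sum>i<n. \<Sum>j<n. w i j * (2 * (u i)\<^sup>2)) = (\<Sum>i<n. (\<Sum>j<n. w i j) * (2 * (u i)\<^sup>2))"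
    by (simp add: sum_distrib_right)
  also have "\<dots> \<le> (\<Sum>i<n. d * (2 * (u i)\<^sup>2))"
    by (intro sum_mono mult_right_mono d) auto
  also have "\<dots> = 2 * d * (\<Sum>i<n. (u i)\<^sup>2)" by (simp add: sum_distrib_left mult_ac)
  finally have "e * (\<Sum>i<n. (u i)\<^sup>2) \<le> 2 * d * (\<Sum>i<n. (u i)\<^sup>2)" unfolding eq
    using \<open>(\<Sum>i<n. d * (2 * (u i)\<^sup>2)) = 2 * d * (\<Sum>i<n. (u i)\<^sup>2)\<close> by simp
  with u(2) show "e \<le> 2 * d" by simp
qed

lemma weighted_laplacian_zero_root:
  assumes diag: "\<And>i. w i i = 0" and "n > 0" and cp: "char_poly (weighted_laplacian n w) = (\<Prod>e\<leftarrow>es. [:- e, 1:])"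
  shows "0 \<in> set es"
proof -
  let ?L = "weighted_laplacian n w" and ?u = "vec n (\<lambda>_. 1 :: real)"
  have "?L *\<^sub>v ?u = 0 \<cdot>\<^sub>v ?u"
  proof (rule eq_vecI)
    fix i assume i: "i < dim_vec (0 \<cdot>\<^sub>v ?u)"
    have "(?L *\<^sub>v ?u) $ i = (\<Sum>j<n. (if i = j then (\<Sum>k<n. w i k) else 0) - w i j)"
      using i by (auto simp: weighted_laplacian_def scalar_prod_def lessThan_atLeast0 diag intro!: sum.cong)
    also have "\<dots> = 0" using i by (simp add: sum_subtractf)
    finally show "(?L *\<^sub>v ?u) $ i = (0 \<cdot>\<^sub>v ?u) $ i" using i by simp
  qed (simp add: weighted_laplacian_def)
  moreover have "?u \<noteq> 0\<^sub>v n" using assms(2) by (auto simp: vec_eq_iff)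
  ultimately have "eigenvalue ?L 0" unfolding eigenvalue_def eigenvector_def
    by (intro exI[of _ ?u]) (simp add: weighted_laplacian_def)
  then have "poly (char_poly ?L) 0 = 0" using eigenvalue_root_char_poly[OF weighted_laplacian_carrier] by blast
  then show ?thesis unfolding cp by (induction es) auto
qed

text \<open>The shifted matrix is D - W with D diagonal and W of zero diagonal. In the traces of its
  powers, tr W, tr (D W) and tr (D^2 W) vanish, which leaves tr D^2 + tr W^2 and tr D^3 + 3 tr (D
  W^2) - tr W^3.\<close>

lemma weighted_laplacian_moments:
  fixes n :: nat and w :: "nat \<Rightarrow> nat \<Rightarrow> real" and c :: real
  assumes sym: "\<And>i j. w i j = w j i" and diag: "\<And>i. w i i = 0"
    and cp: "char_poly (weighted_laplacian n w) = (\<Prod>e\<leftarrow>es. [:- e, 1:])"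
  defines "d \<equiv> \<lambda>i. (\<Sum>k<n. w i k) - c"
  shows "(\<Sum>e\<leftarrow>es. e - c) = (\<Sum>i<n. d i)"
    and "(\<Sum>e\<leftarrow>es. (e - c)\<^sup>2) = (\<Sum>i<n. (d i)\<^sup>2) + (\<Sum>i<n. \<Sum>j<n. (w i j)\<^sup>2)"
    and "(\<Sum>e\<leftarrow>es. (e - c) ^ 3) = (\<Sum>i<n. (d i) ^ 3) + 3 * (\<Sum>i<n. d i * (\<Sum>j<n. (w i j)\<^sup>2))
           - (\<Sum>i<n. \<Sum>j<n. \<Sum>k<n. w i j * w j k * w k i)"
proof -
  let ?C = "char_matrix (weighted_laplacian n w) c"
  note tr = trace_char_matrix_pow[OF weighted_laplacian_carrier cp, of c]
  have C: "?C \<in> carrier_mat n n" by simp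
  then have dC: "dim_row ?C = n" by blast
  have CC: "?C * ?C \<in> carrier_mat n n" using mult_carrier_mat[OF C C] .
  have ent: "?C $$ (i, j) = (if i = j then d i else 0) - w i j" if "i < n" "j < n" for i j
    using that by (auto simp: weighted_laplacian_def char_matrix_def diag d_def)
  have sq: "(?C * ?C) $$ (i, j) = (if i = j then (d i)\<^sup>2 else 0) - (d i + d j) * w i j + (\<Sum>k<n. w i k * w k j)"
    if "i < n" "j < n" for i j
  proof -
    have "(?C * ?C) $$ (i, j) = (\<Sum>l<n. ?C $$ (i, l) * ?C $$ (l, j))"
      by (rule index_mult_mat_sum[OF C C that])
    also have "\<dots> = (\<Sum>l<n. (if i = l then (if i = j then (d i)\<^sup>2 else 0) - d i * w i j else 0)
        - (if l = j then d j * w i j else 0) + w i l * w l j)"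
      using that by (intro sum.cong refl) (auto simp: ent power2_eq_square algebra_simps diag)
    also have "\<dots> = (if i = j then (d i)\<^sup>2 else 0) - (d i + d j) * w i j + (\<Sum>k<n. w i k * w k j)"
      using that by (simp add: sum.distrib sum_subtractf algebra_simps)
    finally show ?thesis .
  qed
  have "(\<Sum>e\<leftarrow>es. e - c) = mat_trace (?C ^\<^sub>m 1)" using tr[of 1] by simp
  also have "?C ^\<^sub>m 1 = ?C" using C by simp
  also have "mat_trace ?C = (\<Sum>i<n. d i)" unfolding mat_trace_def dC by (simp add: ent diag)
  finally show "(\<Sum>e\<leftarrow>es. e - c) = (\<Sum>i<n. d i)" .
  have "(\<Sum>e\<leftarrow>es. (e - c)\<^sup>2) = mat_trace (?C ^\<^sub>m 2)" using tr[of 2] by simp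
  also have "?C ^\<^sub>m 2 = ?C * ?C" using C by (simp add: numeral_2_eq_2)
  also have "mat_trace (?C * ?C) = (\<Sum>i<n. (d i)\<^sup>2 + (\<Sum>j<n. (w i j)\<^sup>2))"
    unfolding mat_trace_def by (auto simp: dC sq diag power2_eq_square sum.distrib intro!: sum.cong simp del: index_mult_mat(1)) (metis sym)
  finally show "(\<Sum>e\<leftarrow>es. (e - c)\<^sup>2) = (\<Sum>i<n. (d i)\<^sup>2) + (\<Sum>i<n. \<Sum>j<n. (w i j)\<^sup>2)"
    by (simp add: sum.distrib)
  have "(\<Sum>e\<leftarrow>es. (e - c) ^ 3) = mat_trace (?C ^\<^sub>m 3)" using tr[of 3] by simp
  also have "?C ^\<^sub>m 3 = ?C * ?C * ?C" using C by (simp add: numeral_3_eq_3)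
  also have "mat_trace (?C * ?C * ?C) = (\<Sum>i<n. \<Sum>j<n. (?C * ?C) $$ (i, j) * ?C $$ (j, i))"
    unfolding mat_trace_def by (auto simp: dC index_mult_mat_sum[OF CC C] intro!: sum.cong simp del: index_mult_mat(1))
  \<comment> \<open>One copy of tr (D W^2) comes from the diagonal entries; the other two come from
    the factor \<open>d i + d j\<close> in the off-diagonal entries of the square.\<close>
  also have "\<dots> = (\<Sum>i<n. \<Sum>j<n. (if i = j then (d i)^3 + d i * (\<Sum>k<n. w i k * w k i) else 0)
      + (d i * (w i j)\<^sup>2 + d j * (w i j)\<^sup>2) - (\<Sum>k<n. w i k * w k j * w j i))"
    by (intro sum.cong refl) (auto simp: ent sq diag power2_eq_square power3_eq_cube algebra_simps sum_distrib_left sym sum_negf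
      simp del: index_mult_mat(1))
  also have "\<dots> = (\<Sum>i<n. (d i)^3) + (\<Sum>i<n. d i * (\<Sum>k<n. w i k * w k i))
      + ((\<Sum>i<n. \<Sum>j<n. d i * (w i j)\<^sup>2) + (\<Sum>i<n. \<Sum>j<n. d j * (w i j)\<^sup>2))
      - (\<Sum>i<n. \<Sum>j<n. \<Sum>k<n. w i k * w k j * w j i)"
    by (simp add: sum.distrib sum_subtractf)
  also have "(\<Sum>i<n. \<Sum>j<n. d j * (w i j)\<^sup>2) = (\<Sum>i<n. \<Sum>j<n. d i * (w i j)\<^sup>2)"
    by (subst sum.swap) (simp add: sym)
  also have "(\<Sum>i<n. \<Sum>j<n. \<Sum>k<n. w i k * w k j * w j i) = (\<Sum>i<n. \<Sum>j<n. \<Sum>k<n. w i j * w j k * w k i)"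
    by (intro sum.cong refl sum.swap)
  also have "(\<Sum>i<n. d i * (\<Sum>k<n. w i k * w k i)) = (\<Sum>i<n. d i * (\<Sum>j<n. (w i j)\<^sup>2))"
    by (intro sum.cong refl arg_cong2[of _ _ _ _ "(*)"]) (metis sym power2_eq_square)
  also have "(\<Sum>i<n. \<Sum>j<n. d i * (w i j)\<^sup>2) = (\<Sum>i<n. d i * (\<Sum>j<n. (w i j)\<^sup>2))"
    by (simp add: sum_distrib_left)
  finally show "(\<Sum>e\<leftarrow>es. (e - c) ^ 3) = (\<Sum>i<n. (d i) ^ 3) + 3 * (\<Sum>i<n. d i * (\<Sum>j<n. (w i j)\<^sup>2))
           - (\<Sum>i<n. \<Sum>j<n. \<Sum>k<n. w i j * w j k * w k i)"
    by simp
qed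

section \<open>Determinants and incidence matrices\<close>

definition incidence_like :: "nat \<Rightarrow> real mat \<Rightarrow> bool" where
  "incidence_like n N \<longleftrightarrow> N \<in> carrier_mat n n \<and>
     (\<forall>j<n. (\<forall>i<n. N $$ (i, j) \<in> {-1, 0, 1}) \<and>
       (\<forall>i<n. \<forall>k<n. N $$ (i, j) = N $$ (k, j) \<and> N $$ (i, j) \<noteq> 0 \<longrightarrow> i = k))"

lemma incidence_like_mat_delete:
  assumes N: "incidence_like (Suc n) N" and "a < Suc n" "b < Suc n"
  shows "incidence_like n (mat_delete N a b)"
proof -
  define f where "f = (\<lambda>c i :: nat. if i < c then i else Suc i)"
  have fi: "f c i = f c k \<longleftrightarrow> i = k" for c i k unfolding f_def by auto
  have fl: "f c i < Suc n" if "i < n" for c i using that unfolding f_def by auto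
  have ent: "mat_delete N a b $$ (i, j) = N $$ (f a i, f b j)" if "i < n" "j < n" for i j
    using that N unfolding mat_delete_def f_def incidence_like_def by auto
  have "mat_delete N a b \<in> carrier_mat n n"
    using N mat_delete_carrier[of N "Suc n" "Suc n" a b] by (simp add: incidence_like_def)
  moreover have "N $$ (f a i, f b j) \<in> {-1, 0, 1}" if "i < n" "j < n" for i j
    using N fl[OF that(1), of a] fl[OF that(2), of b] unfolding incidence_like_def by blast
  moreover have "i = k" if "i < n" "k < n" "j < n"
      "N $$ (f a i, f b j) = N $$ (f a k, f b j)" "N $$ (f a i, f b j) \<noteq> 0" for i j k
  proof -
    have "f a i = f a k"
      using N that fl[OF that(1), of a] fl[OF that(2), of a] fl[OF that(3), of b]
      unfolding incidence_like_def by blast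
    then show ?thesis by (simp add: fi)
  qed
  ultimately show ?thesis unfolding incidence_like_def by (auto simp: ent)
qed

lemma det_zero_if_column_sums_zero:
  fixes N :: "real mat"
  assumes N: "N \<in> carrier_mat n n" and "n > 0" and s: "\<And>j. j < n \<Longrightarrow> (\<Sum>i<n. N $$ (i, j)) = 0"
  shows "det N = 0"
proof -
  let ?u = "vec n (\<lambda>_. 1 :: real)"
  have "transpose_mat N *\<^sub>v ?u = 0\<^sub>v n"
    using N s by (intro eq_vecI) (auto simp: scalar_prod_def lessThan_atLeast0)
  moreover have "?u \<noteq> 0\<^sub>v n" using assms(2) by (auto simp: vec_eq_iff)
  ultimately have "det (transpose_mat N) = 0"
    using N by (subst det_0_iff_vec_prod_zero[of _ n]) (auto intro!: exI[of _ ?u])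
  then show ?thesis using det_transpose[OF N] by simp
qed

text \<open>Total unimodularity by induction on the size. If some column has at most one nonzero
  entry, expand along it; otherwise every column consists of one 1, one -1 and zeros, so all column
  sums vanish and the matrix is singular.\<close>

lemma det_incidence_like_le_1: "incidence_like n N \<Longrightarrow> \<bar>det N\<bar> \<le> 1"
proof (induction n arbitrary: N)
  case 0
  then show ?case by (simp add: incidence_like_def)
next
  case (Suc n)
  have N: "N \<in> carrier_mat (Suc n) (Suc n)" using Suc.prems by (simp add: incidence_like_def)
  show ?case
  proof (cases "\<exists>j<Suc n. \<exists>k<Suc n. \<forall>i<Suc n. i \<noteq> k \<longrightarrow> N $$ (i, j) = 0")
    case True
    then obtain j k where jk: "j < Suc n" "k < Suc n" and z: "\<And>i. i < Suc n \<Longrightarrow> i \<noteq> k \<Longrightarrow> N $$ (i, j) = 0" by blast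
    have "det N = (\<Sum>i<Suc n. N $$ (i, j) * cofactor N i j)"
      by (rule laplace_expansion_column[OF N jk(1)])
    also have "\<dots> = (\<Sum>i\<in>{k}. N $$ (i, j) * cofactor N i j)"
      using jk z by (intro sum.mono_neutral_right) auto
    finally have "\<bar>det N\<bar> = \<bar>N $$ (k, j)\<bar> * \<bar>det (mat_delete N k j)\<bar>"
      by (simp add: cofactor_def abs_mult power_abs)
    also have "N $$ (k, j) \<in> {-1, 0, 1}"
      using Suc.prems jk unfolding incidence_like_def by blast
    then have "\<bar>N $$ (k, j)\<bar> * \<bar>det (mat_delete N k j)\<bar> \<le> 1 * 1"
      using Suc.prems jk by (intro mult_mono Suc.IH incidence_like_mat_delete) auto
    finally show ?thesis by simp
  next
    case False
    have "(\<Sum>i<Suc n. N $$ (i, j)) = 0" if j: "j < Suc n" for j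
    proof -
      have *: "N $$ (i, j) \<in> {-1, 0, 1}" "N $$ (i, j) = N $$ (k, j) \<Longrightarrow> N $$ (i, j) \<noteq> 0 \<Longrightarrow> i = k"
        if "i < Suc n" "k < Suc n" for i k
        using that j Suc.prems unfolding incidence_like_def by blast+
      obtain a where a: "a < Suc n" "N $$ (a, j) \<noteq> 0" using False j by blast
      obtain b where b: "b < Suc n" "b \<noteq> a" "N $$ (b, j) \<noteq> 0" using False j a by blast
      have ab: "N $$ (a, j) + N $$ (b, j) = 0" using *[of a b] *(1)[of b b] a b by auto
      have "N $$ (i, j) = 0" if "i < Suc n" "i \<noteq> a" "i \<noteq> b" for i
        using *[of i a] *[of i b] that a b ab *(1)[of a a] *(1)[of b b] by auto
      then have "(\<Sum>i<Suc n. N $$ (i, j)) = (\<Sum>i\<in>{a, b}. N $$ (i, j))"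
        using a b by (intro sum.mono_neutral_right) auto
      then show ?thesis using b ab by simp
    qed
    then have "det N = 0" by (intro det_zero_if_column_sums_zero[OF N]) auto
    then show ?thesis by simp
  qed
qed

definition replace_row0 :: "real mat \<Rightarrow> (nat \<Rightarrow> real) \<Rightarrow> real mat" where
  "replace_row0 A z = mat (dim_row A) (dim_col A) (\<lambda>(i, j). if i = 0 then z j else A $$ (i, j))"

text \<open>Expansion along the new row pairs the unit vector \<open>z\<close> with cofactors that
  are, up to sign, minors of \<open>N\<close> and hence at most 1 in absolute value. The
  Cauchy-Schwarz inequality finishes.\<close>

lemma det_replace_row0_incidence_like:
  assumes N: "incidence_like n N" and "n > 0" and z: "(\<Sum>j<n. (z j)\<^sup>2) = 1"
  shows "(det (replace_row0 N z))\<^sup>2 \<le> real n"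
proof -
  let ?M = "replace_row0 N z"
  have Nc: "N \<in> carrier_mat n n" using N by (simp add: incidence_like_def)
  then have M: "?M \<in> carrier_mat n n" by (auto simp: replace_row0_def)
  obtain m where m: "n = Suc m" using assms(2) by (cases n) auto
  have del: "mat_delete ?M 0 j = mat_delete N 0 j" if "j < n" for j
    using that Nc by (auto simp: mat_delete_def replace_row0_def)
  have "\<bar>det (mat_delete N 0 j)\<bar> \<le> 1" if "j < n" for j
    using that N m by (intro det_incidence_like_le_1[of m] incidence_like_mat_delete) auto
  then have cof: "\<bar>cofactor ?M 0 j\<bar> \<le> 1" if "j < n" for j
    using that by (simp add: cofactor_def abs_mult power_abs del)
  have "det ?M = (\<Sum>j<n. ?M $$ (0, j) * cofactor ?M 0 j)"
    by (rule laplace_expansion_row[OF M assms(2)])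
  also have "\<dots> = (\<Sum>j<n. z j * cofactor ?M 0 j)"
    using Nc assms(2) by (intro sum.cong refl) (auto simp: replace_row0_def)
  finally have "(det ?M)\<^sup>2 \<le> (\<Sum>j<n. (z j)\<^sup>2) * (\<Sum>j<n. (cofactor ?M 0 j)\<^sup>2)"
    by (simp only: Cauchy_Schwarz_ineq_sum)
  also have "\<dots> \<le> 1 * (\<Sum>j<n. 1)"
    unfolding z using cof by (intro mult_left_mono sum_mono) (auto simp: abs_square_le_1)
  finally show ?thesis by simp
qed

text \<open>Let M be \<open>N\<close> with row 0 replaced by \<open>z\<close>, and let
  \<open>R\<close> be \<open>N\<close> with \<open>z\<close> added to every row. Since
  \<open>z\<close> is a unit vector in the kernel of \<open>N\<close>, M times the transpose of
  \<open>R\<close> is the bordered Gram matrix, while row operations give det R = n det M.\<close>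

lemma det_bordered_gram:
  assumes N: "N \<in> carrier_mat n n" and n: "n > 0"
    and col: "\<And>j. j < n \<Longrightarrow> (\<Sum>i<n. N $$ (i, j)) = 0"
    and ker: "\<And>i. i < n \<Longrightarrow> (\<Sum>j<n. N $$ (i, j) * z j) = 0" and z: "(\<Sum>j<n. (z j)\<^sup>2) = 1"
  shows "det (replace_row0 (N * transpose_mat N) (\<lambda>_. 1)) = real n * (det (replace_row0 N z))\<^sup>2"
proof -
  define R where "R = mat n n (\<lambda>(i, j). N $$ (i, j) + z j)"
  \<comment> \<open>\<open>F1\<close> adds all rows to row 0, which turns row 0 of \<open>R\<close>
    into n z because the columns of \<open>N\<close> sum to zero. \<open>F2\<close> divides row 0 by
    n and subtracts the result from every other row.\<close>
  define F1 where "F1 = mat n n (\<lambda>(i, j). if i = 0 \<or> i = j then 1 else 0 :: real)"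
  define F2 where "F2 = mat n n (\<lambda>(i, j). if j = 0 then if i = 0 then 1 / real n else - 1 / real n else if i = j then 1 else 0)"
  let ?M = "replace_row0 N z" and ?Q = "replace_row0 (N * transpose_mat N) (\<lambda>_. 1)"
  have car: "R \<in> carrier_mat n n" "F1 \<in> carrier_mat n n" "F2 \<in> carrier_mat n n" "?M \<in> carrier_mat n n"
      "transpose_mat N \<in> carrier_mat n n"
    using N by (auto simp: R_def F1_def F2_def replace_row0_def)
  have F1R: "(F1 * R) $$ (i, j) = (if i = 0 then real n * z j else N $$ (i, j) + z j)" if "i < n" "j < n" for i j
  proof -
    have "(F1 * R) $$ (i, j) = (\<Sum>k<n. (if i = 0 \<or> i = k then 1 else 0) * (N $$ (k, j) + z j))"
      unfolding index_mult_mat_sum[OF car(2,1) that] using that by (intro sum.cong) (auto simp: F1_def R_def)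
    also have "\<dots> = (if i = 0 then real n * z j else N $$ (i, j) + z j)"
      using that col[OF that(2)] by (cases "i = 0") (auto simp: sum.distrib if_distrib[of "\<lambda>x. x * _"] cong: if_cong)
    finally show ?thesis .
  qed
  have "F2 * (F1 * R) = ?M"
  proof (rule eq_matI)
    fix i j assume "i < dim_row ?M" "j < dim_col ?M"
    then have ij: "i < n" "j < n" using N by (auto simp: replace_row0_def)
    have "(F2 * (F1 * R)) $$ (i, j) = (\<Sum>k<n. F2 $$ (i, k) * (F1 * R) $$ (k, j))"
      by (rule index_mult_mat_sum[OF car(3) mult_carrier_mat[OF car(2,1)] ij])
    also have "\<dots> = (\<Sum>k<n. (if k = 0 then (if i = 0 then 1 else - 1) * z j else 0)
        + (if k = i then if i = 0 then 0 else N $$ (i, j) + z j else 0))"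
      using ij n by (intro sum.cong) (auto simp: F2_def F1R simp del: index_mult_mat(1))
    also have "\<dots> = (if i = 0 then z j else N $$ (i, j))"
      using ij n by (simp add: sum.distrib)
    finally show "(F2 * (F1 * R)) $$ (i, j) = ?M $$ (i, j)"
      using ij N by (simp add: replace_row0_def)
  qed (use car N in \<open>auto simp: replace_row0_def\<close>)
  moreover have "det F1 = 1"
    by (subst det_upper_triangular[OF _ car(2)]) (auto simp: F1_def upper_triangular_def prod_list_diag_prod intro!: prod.neutral)
  moreover have "det F2 = 1 / real n"
  proof -
    have "det F2 = prod_list (diag_mat F2)"
      by (rule det_lower_triangular[OF _ car(3)]) (auto simp: F2_def)
    also have "\<dots> = (\<Prod>i = 0..<n. if i = 0 then 1 / real n else 1)"
      unfolding prod_list_diag_prod by (rule prod.cong) (auto simp: F2_def)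
    also have "\<dots> = 1 / real n" using n by simp
    finally show ?thesis .
  qed
  ultimately have "det ?M = 1 / real n * (1 * det R)"
    using det_mult[OF car(3) mult_carrier_mat[OF car(2,1)]] det_mult[OF car(2,1)] by simp
  then have R: "det R = real n * det ?M" using n by simp
  have "?M * transpose_mat R = ?Q"
  proof (rule eq_matI)
    fix i j assume "i < dim_row ?Q" "j < dim_col ?Q"
    then have ij: "i < n" "j < n" using N by (auto simp: replace_row0_def)
    have "(?M * transpose_mat R) $$ (i, j) = (\<Sum>k<n. (if i = 0 then z k else N $$ (i, k)) * (N $$ (j, k) + z k))"
      using ij car N by (subst index_mult_mat_sum[of _ n n _ n]) (auto simp: replace_row0_def R_def intro!: sum.cong)
    also have "\<dots> = (if i = 0 then 1 else (\<Sum>k<n. N $$ (i, k) * N $$ (j, k)))"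
      using z ker[OF ij(2)] ker[OF ij(1)] by (simp add: distrib_left sum.distrib power2_eq_square mult.commute)
    also have "(\<Sum>k<n. N $$ (i, k) * N $$ (j, k)) = (N * transpose_mat N) $$ (i, j)"
      using ij N car by (subst index_mult_mat_sum[OF N car(5)]) auto
    finally show "(?M * transpose_mat R) $$ (i, j) = ?Q $$ (i, j)"
      using ij N by (simp add: replace_row0_def)
  qed (use car N in \<open>auto simp: replace_row0_def\<close>)
  then have "det ?Q = det ?M * det R"
    using det_mult[OF car(4), of "transpose_mat R"] car det_transpose[OF car(1)] by auto
  then show ?thesis by (simp add: R power2_eq_square)
qed

lemma sum_const_poly: "(\<Sum>i\<in>A. [:f i:]) = [:\<Sum>i\<in>A. f i :: 'a::comm_ring_1:]"
  by (induction A rule: infinite_finite_induct) auto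

text \<open>Adding all rows of X I - L to row 0 makes that row constantly X, because the columns of
  \<open>L\<close> sum to zero. Cancelling this factor X against the eigenvalue 0 and evaluating at
  X = 0 gives both sides up to sign.\<close>

lemma abs_prod_nonzero_eigenvalues:
  fixes L :: "real mat"
  assumes L: "L \<in> carrier_mat n n" and n: "n > 0" and col: "\<And>j. j < n \<Longrightarrow> (\<Sum>i<n. L $$ (i, j)) = 0"
    and cp: "char_poly L = (\<Prod>e\<leftarrow>es. [:- e, 1:])" and z: "0 \<in> set es"
  shows "\<bar>prod_list (remove1 0 es)\<bar> = \<bar>det (replace_row0 L (\<lambda>_. 1))\<bar>"
proof -
  let ?X = "char_poly_matrix L" and ?Q = "replace_row0 L (\<lambda>_. 1)"
  define F where "F = mat n n (\<lambda>(i, j). if i = 0 \<or> i = j then 1 else 0 :: real poly)"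
  define G where "G = mat n n (\<lambda>(i, j). if i = 0 then 1 else ?X $$ (i, j))"
  define H where "H = mat n n (\<lambda>(i, j). if i = 0 then 1 else - L $$ (i, j))"
  define S where "S = mat n n (\<lambda>(i, j). if i = j then if i = 0 then 1 else - 1 else 0 :: real)"
  have car: "?X \<in> carrier_mat n n" "F \<in> carrier_mat n n" "G \<in> carrier_mat n n" "H \<in> carrier_mat n n"
     "S \<in> carrier_mat n n" "?Q \<in> carrier_mat n n"
    using L by (auto simp: F_def G_def H_def S_def replace_row0_def)
  have X: "?X $$ (i, j) = (if i = j then [:0, 1:] else 0) - [:L $$ (i, j):]" if "i < n" "j < n" for i j
    using that L by (auto simp: char_poly_matrix_def)
  have Xcol: "(\<Sum>i<n. ?X $$ (i, j)) = [:0, 1:]" if "j < n" for j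
  proof -
    have "(\<Sum>i<n. ?X $$ (i, j)) = (\<Sum>i<n. (if i = j then [:0, 1:] else 0) - [:L $$ (i, j):])"
      using that by (intro sum.cong) (auto simp: X)
    also have "\<dots> = [:0, 1:] - [:\<Sum>i<n. L $$ (i, j):]"
      using that by (simp add: sum_subtractf sum_const_poly del: diff_pCons)
    finally show ?thesis using col[OF that] by simp
  qed
  have "F * ?X = multrow 0 [:0, 1:] G"
  proof (rule eq_matI)
    fix i j assume "i < dim_row (multrow 0 [:0, 1:] G)" "j < dim_col (multrow 0 [:0, 1:] G)"
    then have ij: "i < n" "j < n" using car by auto
    have "(F * ?X) $$ (i, j) = (\<Sum>k<n. (if i = 0 \<or> i = k then 1 else 0) * ?X $$ (k, j))"
      unfolding index_mult_mat_sum[OF car(2,1) ij] using ij by (intro sum.cong) (auto simp: F_def)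
    also have "\<dots> = (if i = 0 then [:0, 1:] else ?X $$ (i, j))"
      using ij Xcol by (cases "i = 0") (auto simp: if_distrib[of "\<lambda>x. x * _"] cong: if_cong)
    finally show "(F * ?X) $$ (i, j) = multrow 0 [:0, 1:] G $$ (i, j)"
      using ij car by (auto simp: G_def)
  qed (use car in auto)
  moreover have "det F = 1"
    by (subst det_upper_triangular[OF _ car(2)]) (auto simp: F_def upper_triangular_def prod_list_diag_prod intro!: prod.neutral)
  ultimately have "char_poly L = [:0, 1:] * det G"
    using det_mult[OF car(2,1)] det_multrow[OF n car(3)] by (simp add: char_poly_def)
  moreover have "char_poly L = [:0, 1:] * (\<Prod>e\<leftarrow>remove1 0 es. [:- e, 1:])"
  proof -
    have "mset es = add_mset 0 (mset (remove1 0 es))" using z by simp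
    then have "prod_mset (image_mset (\<lambda>e. [:- e, 1:]) (mset es)) = [:0, 1:] * prod_mset (image_mset (\<lambda>e. [:- e, 1:]) (mset (remove1 0 es)))"
      by (simp only: image_mset_add_mset prod_mset.add_mset) simp
    then show ?thesis unfolding cp by (simp only: mset_map[symmetric] prod_mset_prod_list)
  qed
  ultimately have "det G = (\<Prod>e\<leftarrow>remove1 0 es. [:- e, 1:])" by (metis mult_left_cancel pCons_eq_0_iff zero_neq_one)
  moreover have "poly (det G) 0 = det H"
    by (rule poly_det_cong[OF car(4,3)]) (auto simp: G_def H_def X)
  ultimately have "det H = (\<Prod>e\<leftarrow>remove1 0 es. - e)"
    by (simp add: poly_prod_list comp_def)
  moreover have "\<bar>\<Prod>e\<leftarrow>xs. - e\<bar> = \<bar>prod_list xs\<bar>" for xs :: "real list"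
    by (induction xs) (auto simp: abs_mult)
  moreover have "S * ?Q = H"
  proof (rule eq_matI)
    fix i j assume "i < dim_row H" "j < dim_col H"
    then have ij: "i < n" "j < n" using car by auto
    have "(S * ?Q) $$ (i, j) = (\<Sum>k<n. if k = i then (if i = 0 then 1 else - 1) * ?Q $$ (i, j) else 0)"
      unfolding index_mult_mat_sum[OF car(5,6) ij] using ij by (intro sum.cong) (auto simp: S_def)
    also have "\<dots> = H $$ (i, j)"
      using ij L by (auto simp: H_def replace_row0_def)
    finally show "(S * ?Q) $$ (i, j) = H $$ (i, j)" .
  qed (use car in auto)
  moreover have "\<bar>det S\<bar> = 1"
    by (subst det_upper_triangular[OF _ car(5)])
      (auto simp: S_def upper_triangular_def prod_list_diag_prod abs_prod intro!: prod.neutral)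
  ultimately show ?thesis using det_mult[OF car(5,6)] by (metis abs_mult mult_1)
qed

section \<open>Laplacians of designs as weighted Laplacians and as Gram matrices\<close>

abbreviation multiplicity_in :: "nat set multiset \<Rightarrow> nat \<Rightarrow> nat \<Rightarrow> real" where
  "multiplicity_in E i j \<equiv> real (count E {i, j})"

lemma binary_design_count_singleton [simp]: "binary_design v E \<Longrightarrow> count E {i} = 0"
  by (force simp: binary_design_def not_in_iff[symmetric])

lemma degree_in_eq_sum:
  assumes "binary_design v E" "i < v"
  shows "degree_in E i = (\<Sum>j<v. count E {i, j})"
  using assms(1)
proof (induction E)
  case (add e E)
  then have e: "e \<subseteq> {..<v}" "card e = 2" and E: "binary_design v E" by (auto simp: binary_design_def)
  obtain p q where pq: "e = {p, q}" "p \<noteq> q" using e(2) by (auto simp: card_2_iff)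
  have "(\<Sum>j<v. if e = {i, j} then 1 else 0) = (if i \<in> e then 1 else 0 :: nat)"
  proof (cases "i \<in> e")
    case True
    then obtain r where r: "e = {i, r}" "r \<noteq> i" using pq by auto
    then have "(\<Sum>j<v. if e = {i, j} then 1 else 0) = (\<Sum>j<v. if j = r then 1 else 0 :: nat)"
      by (intro sum.cong) (auto simp: doubleton_eq_iff)
    also have "\<dots> = 1" using r e(1) by simp
    finally show ?thesis using True by simp
  qed auto
  moreover have "degree_in (add_mset e E) i = degree_in E i + (if i \<in> e then 1 else 0)"
    by (simp add: degree_in_def)
  moreover have "(\<Sum>j<v. count (add_mset e E) {i, j}) = (\<Sum>j<v. count E {i, j}) + (\<Sum>j<v. if e = {i, j} then 1 else 0)"
    unfolding sum.distrib[symmetric] by (intro sum.cong) auto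
  ultimately show ?case using add.IH[OF E] by simp
qed (simp add: degree_in_def)

lemma laplacian_eq_weighted:
  assumes "binary_design v E"
  shows "laplacian v E = weighted_laplacian v (multiplicity_in E)"
  using assms by (intro eq_matI)
    (auto simp: laplacian_def adjacency_def weighted_laplacian_def mat_diag_def degree_in_eq_sum)

lemma sum_degree_in:
  assumes "binary_design v E"
  shows "(\<Sum>i<v. degree_in E i) = 2 * size E"
  using assms
proof (induction E)
  case (add e E)
  then have e: "e \<subseteq> {..<v}" "card e = 2" and E: "binary_design v E" by (auto simp: binary_design_def)
  have "(\<Sum>i<v. degree_in (add_mset e E) i) = (\<Sum>i<v. degree_in E i + (if i \<in> e then 1 else 0))"
    by (intro sum.cong) (auto simp: degree_in_def)
  also have "\<dots> = 2 * size E + card ({..<v} \<inter> e)"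
    using add.IH[OF E] by (simp add: sum.distrib sum.If_cases)
  also have "{..<v} \<inter> e = e" using e by auto
  finally show ?case using e by simp
qed (simp add: degree_in_def)

text \<open>Edge \<open>j\<close> is oriented from one endpoint to the other; the choice of
  direction drops out of the Gram matrix. The matrix is square because there are as many edges as
  vertices.\<close>

definition incidence :: "nat \<Rightarrow> (nat \<Rightarrow> nat) \<Rightarrow> (nat \<Rightarrow> nat) \<Rightarrow> real mat" where
  "incidence n s t = mat n n (\<lambda>(i, j). (if i = s j then 1 else 0) - (if i = t j then 1 else 0))"

lemma incidence_column_sum:
  assumes "j < n" "s j < n" "t j < n"
  shows "(\<Sum>i<n. incidence n s t $$ (i, j)) = 0"
proof -
  have "(\<Sum>i<n. incidence n s t $$ (i, j)) = (\<Sum>i<n. (if i = s j then 1 else 0) - (if i = t j then 1 else 0))"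
    using assms by (intro sum.cong) (auto simp: incidence_def)
  also have "\<dots> = 0" using assms by (simp add: sum_subtractf)
  finally show ?thesis .
qed

lemma incidence_like_incidence:
  assumes "\<And>j. j < n \<Longrightarrow> s j \<noteq> t j"
  shows "incidence_like n (incidence n s t)"
  using assms unfolding incidence_like_def incidence_def by (auto split: if_splits)

lemma count_image_mset_sum:
  "finite A \<Longrightarrow> count (image_mset f (mset_set A)) x = (\<Sum>i\<in>A. if f i = x then 1 else 0)"
  by (induction rule: finite_induct) auto

lemma laplacian_eq_incidence_gram:
  assumes E: "E = image_mset (\<lambda>j. {s j, t j}) (mset_set {..<n})" and st: "\<And>j. j < n \<Longrightarrow> s j \<noteq> t j"
    and b: "binary_design n E"
  shows "laplacian n E = incidence n s t * transpose_mat (incidence n s t)"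
proof (rule eq_matI)
  let ?N = "incidence n s t"
  have Nc: "?N \<in> carrier_mat n n" by (simp add: incidence_def)
  fix i k assume "i < dim_row (?N * transpose_mat ?N)" "k < dim_col (?N * transpose_mat ?N)"
  then have ik: "i < n" "k < n" using Nc by auto
  have deg: "size (filter_mset P (image_mset f (mset_set A))) = (\<Sum>j\<in>A. if P (f j) then 1 else 0)" if "finite A"
    for f :: "nat \<Rightarrow> nat set" and A P
    using that by induction auto
  have "(?N * transpose_mat ?N) $$ (i, k) = (\<Sum>j<n. ?N $$ (i, j) * ?N $$ (k, j))"
    using ik Nc by (subst index_mult_mat_sum[OF Nc, of _ n]) auto
  \<comment> \<open>On the diagonal the second indicator is 0, since an edge with
    \<open>s j \<noteq> t j\<close> is never the singleton \<open>{i, i}\<close>; off the diagonal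
    the product is -1 exactly for edges joining \<open>i\<close> and \<open>k\<close>.\<close>
  also have "\<dots> = (\<Sum>j<n. (if i = k then (if i \<in> {s j, t j} then 1 else 0) else 0) - (if {s j, t j} = {i, k} then 1 else 0))"
  proof (intro sum.cong refl)
    fix j assume "j \<in> {..<n}"
    then show "?N $$ (i, j) * ?N $$ (k, j) =
        (if i = k then (if i \<in> {s j, t j} then 1 else 0) else 0) - (if {s j, t j} = {i, k} then 1 else 0)"
      using ik st[of j] by (auto simp: incidence_def doubleton_eq_iff)
  qed
  also have "\<dots> = (if i = k then (\<Sum>j<n. if i \<in> {s j, t j} then 1 else 0) else 0) - (\<Sum>j<n. if {s j, t j} = {i, k} then 1 else 0)"
    unfolding sum_subtractf by (cases "i = k") simp_all
  also have "\<dots> = laplacian n E $$ (i, k)"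
    using ik by (simp add: laplacian_def adjacency_def mat_diag_def degree_in_def E count_image_mset_sum deg of_nat_sum if_distrib[of real] del: insert_iff cong: if_cong)
  finally show "laplacian n E $$ (i, k) = (?N * transpose_mat ?N) $$ (i, k)" by simp
qed (auto simp: laplacian_def adjacency_def incidence_def mat_diag_def)

section \<open>The determinant criterion for y = 0\<close>

lemma D_value_zero:
  assumes b: "binary_design v E" and v: "v > 0"
  shows "D_value v 0 (laplacian v E) = \<bar>det (replace_row0 (laplacian v E) (\<lambda>_. 1))\<bar>"
proof -
  let ?w = "multiplicity_in E"
  have L: "laplacian v E = weighted_laplacian v ?w" by (rule laplacian_eq_weighted[OF b])
  have sym: "?w i j = ?w j i" for i j by (simp add: insert_commute)
  have diag: "?w i i = 0" for i using b by simp
  obtain es where cp: "char_poly (weighted_laplacian v ?w) = (\<Prod>e\<leftarrow>es. [:- e, 1:])"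
    by (rule weighted_laplacian_char_poly_splits[OF sym])
  have z: "0 \<in> set es" by (rule weighted_laplacian_zero_root[OF diag v cp])
  have nn: "0 \<le> e" if "e \<in> set es" for e
    by (rule weighted_laplacian_eigenvalue_bounds(1)[OF sym diag _ cp that]) simp
  have col: "(\<Sum>i<v. weighted_laplacian v ?w $$ (i, j)) = 0" if "j < v" for j
  proof -
    have "(\<Sum>i<v. weighted_laplacian v ?w $$ (i, j)) = (\<Sum>i<v. (if i = j then (\<Sum>k<v. ?w j k) else 0) - ?w j i)"
      using that diag by (intro sum.cong) (auto simp: weighted_laplacian_def sym)
    then show ?thesis using that by (simp add: sum_subtractf)
  qed
  have "nontrivial_eigenvalues (weighted_laplacian v ?w) = mset (remove1 0 es)"
    by (simp add: nontrivial_eigenvalues_def cp proots_prod_linear)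
  then have "D_value v 0 (weighted_laplacian v ?w) = prod_list (remove1 0 es)"
    by (simp add: D_value_def prod_mset_prod_list del: mset_remove1)
  moreover have "prod_list (remove1 0 es) \<ge> 0"
  proof -
    have "set (remove1 0 es) \<subseteq> set es" by (rule set_remove1_subset)
    then have "\<forall>e\<in>set (remove1 0 es). 0 \<le> e" using nn by blast
    then show ?thesis by (induction "remove1 0 es" rule: list.induct) (auto intro: prod_list_nonneg)
  qed
  ultimately show ?thesis
    using abs_prod_nonzero_eigenvalues[OF weighted_laplacian_carrier v col cp z] by (simp add: L)
qed

text \<open>Listing the blocks and orienting each of them writes the Laplacian as a Gram matrix of
  an incidence matrix. The bordered determinant is then v times a squared determinant that is at
  most v.\<close>

lemma D_value_zero_le:
  assumes b: "binary_design v E" and s: "size E = v" and v: "v > 0"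
  shows "D_value v 0 (laplacian v E) \<le> (real v)\<^sup>2"
proof -
  obtain el where el: "mset el = E" using ex_mset by blast
  have len: "length el = v" using s el by (metis size_mset)
  have "\<exists>p q. el ! j = {p, q} \<and> p \<noteq> q \<and> p < v \<and> q < v" if "j < v" for j
  proof -
    have "el ! j \<in># E" using that len el by (metis nth_mem_mset)
    then have "el ! j \<subseteq> {..<v}" "card (el ! j) = 2" using b by (auto simp: binary_design_def)
    then show ?thesis by (auto simp: card_2_iff)
  qed
  then obtain p q where pq: "\<And>j. j < v \<Longrightarrow> el ! j = {p j, q j} \<and> p j \<noteq> q j \<and> p j < v \<and> q j < v"
    by metis
  let ?N = "incidence v p q"
  have Nc: "?N \<in> carrier_mat v v" by (simp add: incidence_def)
  have "E = mset (map (\<lambda>j. el ! j) [0..<v])" using el len map_nth[of el] by simp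
  also have "\<dots> = image_mset (\<lambda>j. el ! j) (mset_set {..<v})"
    by (simp add: mset_set_upto_eq_mset_upto lessThan_atLeast0)
  also have "\<dots> = image_mset (\<lambda>j. {p j, q j}) (mset_set {..<v})"
    using pq by (intro image_mset_cong) auto
  finally have L: "laplacian v E = ?N * transpose_mat ?N"
    using pq b by (intro laplacian_eq_incidence_gram) auto
  have col: "(\<Sum>i<v. ?N $$ (i, j)) = 0" if "j < v" for j
    using pq that by (intro incidence_column_sum) auto
  \<comment> \<open>The vanishing column sums give a left kernel vector; as the matrix is square, it
    also has a right kernel vector, which is normalised to \<open>z\<close> below.\<close>
  obtain u where u: "u \<in> carrier_vec v" "u \<noteq> 0\<^sub>v v" "?N *\<^sub>v u = 0\<^sub>v v"
    using det_zero_if_column_sums_zero[OF Nc v col] det_0_iff_vec_prod_zero[OF Nc] by auto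
  define c where "c = (\<Sum>j<v. (vec_index u j)\<^sup>2)"
  have c: "c > 0"
  proof -
    obtain i where "i < v" "vec_index u i \<noteq> 0" using u by (auto simp: vec_eq_iff)
    then show ?thesis unfolding c_def by (intro sum_pos2[of _ i]) auto
  qed
  define z where "z = (\<lambda>j. vec_index u j / sqrt c)"
  have z: "(\<Sum>j<v. (z j)\<^sup>2) = 1"
    using c by (simp add: z_def power_divide sum_divide_distrib[symmetric] c_def[symmetric])
  have ker: "(\<Sum>j<v. ?N $$ (i, j) * z j) = 0" if "i < v" for i
  proof -
    have "(\<Sum>j<v. ?N $$ (i, j) * vec_index u j) = vec_index (?N *\<^sub>v u) i"
      using that u(1) Nc by (auto simp: scalar_prod_def lessThan_atLeast0)
    then have "(\<Sum>j<v. ?N $$ (i, j) * vec_index u j) = 0" using u(3) that by simp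
    then show ?thesis by (simp add: z_def sum_divide_distrib[symmetric])
  qed
  have "det (replace_row0 (laplacian v E) (\<lambda>_. 1)) = real v * (det (replace_row0 ?N z))\<^sup>2"
    unfolding L by (rule det_bordered_gram[OF Nc v col ker z])
  also have "\<bar>\<dots>\<bar> \<le> real v * real v"
    using det_replace_row0_incidence_like[OF incidence_like_incidence v z] pq
    by (auto simp: abs_mult intro!: mult_left_mono)
  finally show ?thesis using D_value_zero[OF b v] by (simp add: power2_eq_square)
qed

lemma binary_design_Cycle: "v \<ge> 3 \<Longrightarrow> binary_design v (Cycle v)"
  by (auto simp: binary_design_def Cycle_def card_insert_if mod_Suc)

text \<open>With the cycle oriented consistently, the constant unit vector lies in the kernel of the
  incidence matrix. It remains to see that the bordered incidence matrix has determinant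
  \<open>sqrt (real v)\<close>.\<close>

lemma D_value_zero_Cycle:
  assumes v: "v \<ge> 3"
  shows "D_value v 0 (laplacian v (Cycle v)) = (real v)\<^sup>2"
proof -
  have v0: "v > 0" using v by simp
  let ?t = "\<lambda>j. Suc j mod v"
  let ?N = "incidence v (\<lambda>j. j) ?t"
  define z where "z = (\<lambda>j :: nat. 1 / sqrt (real v))"
  have Nc: "?N \<in> carrier_mat v v" by (simp add: incidence_def)
  have b: "binary_design v (Cycle v)" by (rule binary_design_Cycle[OF v])
  have L: "laplacian v (Cycle v) = ?N * transpose_mat ?N"
    using b v by (intro laplacian_eq_incidence_gram) (auto simp: Cycle_def mod_Suc)
  have col: "(\<Sum>i<v. ?N $$ (i, j)) = 0" if "j < v" for j
    using that v by (intro incidence_column_sum) auto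
  have z: "(\<Sum>j<v. (z j)\<^sup>2) = 1" using v by (simp add: z_def power_divide)
  have ker: "(\<Sum>j<v. ?N $$ (i, j) * z j) = 0" if "i < v" for i
  proof -
    \<comment> \<open>The edge entering vertex \<open>i\<close>, namely the cyclic predecessor of
      \<open>i\<close>; the edge leaving it has index \<open>i\<close>.\<close>
    define r where "r = (if i = 0 then v - 1 else i - 1)"
    have "r < v" using that v by (auto simp: r_def)
    have "(\<Sum>j<v. ?N $$ (i, j) * z j) = (\<Sum>j<v. (if j = i then 1 / sqrt (real v) else 0) - (if j = r then 1 / sqrt (real v) else 0))"
      using that v by (intro sum.cong) (auto simp: incidence_def z_def r_def mod_Suc)
    also have "\<dots> = 0" using that \<open>r < v\<close> by (simp add: sum_subtractf)
    finally show ?thesis .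
  qed
  let ?M = "replace_row0 ?N z"
  \<comment> \<open>Right multiplication by \<open>C\<close> replaces each row by its suffix sums.
    Rows other than 0 become unit rows, and the corner entry becomes v / sqrt v.\<close>
  define C where "C = mat v v (\<lambda>(i, j). if j \<le> i then 1 else 0 :: real)"
  have car: "?M \<in> carrier_mat v v" "C \<in> carrier_mat v v" using Nc by (auto simp: replace_row0_def C_def)
  have MC: "(?M * C) $$ (i, j) = (if i = 0 then real (v - j) / sqrt (real v) else if i = j then 1 else 0)"
    if ij: "i < v" "j < v" for i j
  proof (cases "i = 0")
    case True
    have "(?M * C) $$ (i, j) = (\<Sum>k<v. if j \<le> k then 1 / sqrt (real v) else 0)"
      unfolding index_mult_mat_sum[OF car ij] using ij Nc True
      by (intro sum.cong) (auto simp: replace_row0_def C_def z_def)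
    also have "\<dots> = (\<Sum>k\<in>{j..<v}. 1 / sqrt (real v))"
      by (intro sum.mono_neutral_cong_right) auto
    finally show ?thesis using True ij by simp
  next
    case False
    have "(?M * C) $$ (i, j) = (\<Sum>k<v. (if k = i then if j \<le> i then 1 else 0 else 0) - (if k = i - 1 then if j \<le> i - 1 then 1 else 0 else 0))"
      unfolding index_mult_mat_sum[OF car ij] using ij Nc False v
      by (intro sum.cong) (auto simp: replace_row0_def C_def incidence_def mod_Suc)
    also have "\<dots> = (if i = j then 1 else 0)" using ij False by (auto simp: sum_subtractf)
    finally show ?thesis using False by simp
  qed
  have MCc: "?M * C \<in> carrier_mat v v" using car by (rule mult_carrier_mat)
  have "det (?M * C) = prod_list (diag_mat (?M * C))"
    using MC MCc by (intro det_upper_triangular[of _ v]) (auto simp: upper_triangular_def simp del: index_mult_mat(1))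
  also have "\<dots> = (\<Prod>i = 0..<v. if i = 0 then sqrt (real v) else 1)"
    unfolding prod_list_diag_prod using MCc
    by (intro prod.cong) (auto simp: MC real_div_sqrt simp del: index_mult_mat(1))
  also have "\<dots> = sqrt (real v)" using v0 by simp
  finally have "det (?M * C) = sqrt (real v)" .
  moreover have "det C = 1"
    by (subst det_lower_triangular[OF _ car(2)]) (auto simp: C_def prod_list_diag_prod intro!: prod.neutral)
  ultimately have "det ?M = sqrt (real v)" using det_mult[OF car] by simp
  then have "det (replace_row0 (laplacian v (Cycle v)) (\<lambda>_. 1)) = real v * (sqrt (real v))\<^sup>2"
    unfolding L by (subst det_bordered_gram[OF Nc v0 col ker z]) auto
  then show ?thesis using D_value_zero[OF b v0] by (simp add: power2_eq_square)
qed

section \<open>Comparison of two spectra\<close>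

text \<open>The Taylor remainder is exactly t^4 / (a^4 (a + t)), which is nonnegative.\<close>

lemma inverse_cubic_lower:
  fixes a t :: real
  assumes "a > 0" "a + t > 0"
  shows "1 / a - t / a\<^sup>2 + t\<^sup>2 / a ^ 3 - t ^ 3 / a ^ 4 \<le> 1 / (a + t)"
proof -
  have "1 / (a + t) - (1 / a - t / a\<^sup>2 + t\<^sup>2 / a ^ 3 - t ^ 3 / a ^ 4) = t ^ 4 / (a ^ 4 * (a + t))"
    using assms by (simp add: divide_simps power2_eq_square power3_eq_cube power4_eq_xxxx) (simp add: algebra_simps)
  moreover have "t ^ 4 / (a ^ 4 * (a + t)) \<ge> 0" using assms by simp
  ultimately show ?thesis by linarith
qed

text \<open>The interpolating cubic of \<open>1 / (a + t)\<close> at the double node 0 and the nodes 2, -2.\<close>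
lemma inverse_cubic_upper:
  fixes a t :: real
  assumes "a > 2" "\<bar>t\<bar> \<le> 2"
  shows "1 / (a + t) \<le> 1 / a - t / a\<^sup>2 + t\<^sup>2 * (a - t) / (a\<^sup>2 * (a\<^sup>2 - 4))"
proof -
  have pos: "a + t > 0" "a - t > 0" using assms by auto
  have t4: "t\<^sup>2 \<le> 4" using assms(2) abs_le_square_iff[of t 2] by simp
  have a4: "a\<^sup>2 > 4" using assms(1) power_strict_mono[of 2 a 2] by simp
  \<comment> \<open>An exact identity with t^2 in the place of the constant 4 of the bound;
    enlarging t^2 to 4 shrinks the denominator.\<close>
  have "1 / (a + t) = 1 / a - t / a\<^sup>2 + t\<^sup>2 * (a - t) / (a\<^sup>2 * (a\<^sup>2 - t\<^sup>2))"
  proof -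
    have e: "a\<^sup>2 - t\<^sup>2 = (a + t) * (a - t)" by (simp add: power2_eq_square algebra_simps)
    show ?thesis unfolding e using pos assms
      by (simp add: divide_simps) (simp add: power2_eq_square algebra_simps)
  qed
  also have "\<dots> \<le> 1 / a - t / a\<^sup>2 + t\<^sup>2 * (a - t) / (a\<^sup>2 * (a\<^sup>2 - 4))"
    using t4 a4 pos assms(1)
    by (intro add_left_mono divide_left_mono mult_left_mono mult_nonneg_nonneg mult_pos_pos) auto
  finally show ?thesis .
qed

text \<open>Summing the two cubic bounds reduces both sides to power sums, in which the first
  moments vanish. The assumption \<open>gap\<close> is the comparison of the two resulting
  expressions multiplied by a^4, with the common part 2 n a removed.\<close>

lemma sum_inverse_le:
  fixes es fs :: "real list" and x :: real
  defines "a \<equiv> x + 2"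
  assumes x: "x > 0" and len: "length es = n" "length fs = n"
    and es: "\<And>e. e \<in> set es \<Longrightarrow> 0 \<le> e" and fs: "\<And>f. f \<in> set fs \<Longrightarrow> 0 \<le> f \<and> f \<le> 4"
    and e1: "(\<Sum>e\<leftarrow>es. e - 2) = 0" and f1: "(\<Sum>f\<leftarrow>fs. f - 2) = 0"
    and f2: "(\<Sum>f\<leftarrow>fs. (f - 2)\<^sup>2) = 2 * real n"
    and gap: "((\<Sum>e\<leftarrow>es. (e - 2)\<^sup>2) - 2 * real n) * a - (\<Sum>e\<leftarrow>es. (e - 2) ^ 3)
       \<ge> (8 * real n * a - a\<^sup>2 * (\<Sum>f\<leftarrow>fs. (f - 2) ^ 3)) / (a\<^sup>2 - 4)"
  shows "(\<Sum>f\<leftarrow>fs. 1 / (x + f)) \<le> (\<Sum>e\<leftarrow>es. 1 / (x + e))"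
proof -
  have a: "a > 2" using x by (simp add: a_def)
  have a4: "a\<^sup>2 - 4 > 0" using a power_strict_mono[of 2 a 2] by simp
  define E2 where "E2 = (\<Sum>e\<leftarrow>es. (e - 2)\<^sup>2)"
  define E3 where "E3 = (\<Sum>e\<leftarrow>es. (e - 2) ^ 3)"
  define F3 where "F3 = (\<Sum>f\<leftarrow>fs. (f - 2) ^ 3)"
  have "(\<Sum>f\<leftarrow>fs. 1 / (x + f)) \<le> (\<Sum>f\<leftarrow>fs. 1 / a - (f - 2) / a\<^sup>2 + (f - 2)\<^sup>2 * (a - (f - 2)) / (a\<^sup>2 * (a\<^sup>2 - 4)))"
  proof (rule sum_list_mono)
    fix f assume "f \<in> set fs"
    then have "\<bar>f - 2\<bar> \<le> 2" using fs[of f] by auto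
    from inverse_cubic_upper[OF a this] show "1 / (x + f) \<le> 1 / a - (f - 2) / a\<^sup>2 + (f - 2)\<^sup>2 * (a - (f - 2)) / (a\<^sup>2 * (a\<^sup>2 - 4))"
      by (simp add: a_def)
  qed
  also have "\<dots> = real (length fs) / a - (\<Sum>f\<leftarrow>fs. f - 2) / a\<^sup>2 + (a * (\<Sum>f\<leftarrow>fs. (f - 2)\<^sup>2) - F3) / (a\<^sup>2 * (a\<^sup>2 - 4))"
    unfolding F3_def
    by (induction fs) (simp_all add: add_divide_distrib diff_divide_distrib distrib_left right_diff_distrib power2_eq_square power3_eq_cube mult_ac)
  also have "\<dots> = real n / a + (a * (2 * real n) - F3) / (a\<^sup>2 * (a\<^sup>2 - 4))"
    by (simp add: f1 f2 len)
  also have "\<dots> \<le> real n / a + (a * E2 - E3) / a ^ 4"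
  proof -
    have g: "(E2 - 2 * real n) * a - E3 \<ge> (8 * real n * a - a\<^sup>2 * F3) / (a\<^sup>2 - 4)"
      using gap unfolding E2_def E3_def F3_def .
    have "a\<^sup>2 * (a * (2 * real n) - F3) / (a\<^sup>2 - 4) = 2 * real n * a + (8 * real n * a - a\<^sup>2 * F3) / (a\<^sup>2 - 4)"
      using a4 by (simp add: divide_simps) (simp add: algebra_simps power2_eq_square)
    with g have "a\<^sup>2 * (a * (2 * real n) - F3) / (a\<^sup>2 - 4) \<le> a * E2 - E3"
      by (simp add: algebra_simps)
    then have "a\<^sup>2 * (a * (2 * real n) - F3) / (a\<^sup>2 - 4) / a ^ 4 \<le> (a * E2 - E3) / a ^ 4"
      using a by (intro divide_right_mono) auto
    moreover have "a\<^sup>2 * (a * (2 * real n) - F3) / (a\<^sup>2 - 4) / a ^ 4 = (a * (2 * real n) - F3) / (a\<^sup>2 * (a\<^sup>2 - 4))"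
      using a by (simp add: divide_simps power2_eq_square power4_eq_xxxx)
    ultimately show ?thesis by simp
  qed
  also have "\<dots> = real n / a - (\<Sum>e\<leftarrow>es. e - 2) / a\<^sup>2 + E2 / a ^ 3 - E3 / a ^ 4"
    using a e1 by (simp add: diff_divide_distrib power3_eq_cube power4_eq_xxxx)
  also have "\<dots> = (\<Sum>e\<leftarrow>es. 1 / a - (e - 2) / a\<^sup>2 + (e - 2)\<^sup>2 / a ^ 3 - (e - 2) ^ 3 / a ^ 4)"
    unfolding E2_def E3_def len(1)[symmetric]
    by (induction es) (simp_all add: add_divide_distrib diff_divide_distrib)
  also have "\<dots> \<le> (\<Sum>e\<leftarrow>es. 1 / (x + e))"
  proof (rule sum_list_mono)
    fix e assume "e \<in> set es"
    then have "a + (e - 2) > 0" using es[of e] x by (simp add: a_def)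
    from inverse_cubic_lower[OF _ this] a
    show "1 / a - (e - 2) / a\<^sup>2 + (e - 2)\<^sup>2 / a ^ 3 - (e - 2) ^ 3 / a ^ 4 \<le> 1 / (x + e)"
      by (simp add: a_def)
  qed
  finally show ?thesis .
qed

lemma ln_prod_list_add:
  fixes es :: "real list"
  assumes "\<And>e. e \<in> set es \<Longrightarrow> x + e > 0"
  shows "(\<Prod>e\<leftarrow>es. x + e) > 0 \<and> ln (\<Prod>e\<leftarrow>es. x + e) = (\<Sum>e\<leftarrow>es. ln (x + e))"
  using assms
proof (induction es)
  case (Cons e es)
  have "x + e > 0" using Cons.prems[of e] by simp
  moreover have "(\<Prod>e\<leftarrow>es. x + e) > 0 \<and> ln (\<Prod>e\<leftarrow>es. x + e) = (\<Sum>e\<leftarrow>es. ln (x + e))"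
    using Cons by simp
  ultimately show ?case by (simp add: ln_mult_pos)
qed simp

lemma has_derivative_sum_ln:
  fixes es :: "real list"
  assumes "\<And>e. e \<in> set es \<Longrightarrow> x + e > 0"
  shows "((\<lambda>x. \<Sum>e\<leftarrow>es. ln (x + e)) has_real_derivative (\<Sum>e\<leftarrow>es. 1 / (x + e))) (at x)"
  using assms
proof (induction es)
  case (Cons e es)
  have "((\<lambda>x. ln (x + e)) has_real_derivative (1 / (x + e))) (at x)"
    using Cons.prems[of e] by (auto intro!: derivative_eq_intros)
  then show ?case using Cons by (auto intro!: DERIV_add)
qed simp

text \<open>For two lists of equal length the terms in \<open>ln x\<close> cancel, so the difference
  of their logarithmic sums tends to 0.\<close>

lemma sum_ln_asymp:
  fixes es :: "real list"
  shows "((\<lambda>x. (\<Sum>e\<leftarrow>es. ln (x + e)) - real (length es) * ln x) \<longlongrightarrow> 0) at_top"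
proof (induction es)
  case (Cons e es)
  have "((\<lambda>x::real. ln (x + e) - ln x) \<longlongrightarrow> 0) at_top" by real_asymp
  from tendsto_add[OF this Cons] show ?case by (simp add: algebra_simps)
qed simp

text \<open>The logarithm of the quotient of the two products is decreasing in \<open>x\<close> and tends to 0.\<close>
lemma prod_le_if_sum_inverse_le:
  fixes es fs :: "real list"
  assumes x0: "x0 > 0" and len: "length es = length fs"
    and es: "\<And>e. e \<in> set es \<Longrightarrow> 0 \<le> e" and fs: "\<And>f. f \<in> set fs \<Longrightarrow> 0 \<le> f"
    and le: "\<And>x. x \<ge> x0 \<Longrightarrow> (\<Sum>f\<leftarrow>fs. 1 / (x + f)) \<le> (\<Sum>e\<leftarrow>es. 1 / (x + e))"
  shows "(\<Prod>e\<leftarrow>es. x0 + e) \<le> (\<Prod>f\<leftarrow>fs. x0 + f)"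
proof -
  define h where "h = (\<lambda>x. (\<Sum>f\<leftarrow>fs. ln (x + f)) - (\<Sum>e\<leftarrow>es. ln (x + e)))"
  have pos: "x + e > 0" if "x \<ge> x0" "e \<in> set es \<union> set fs" for x e
    using that es[of e] fs[of e] x0 by auto
  have mono: "h b \<le> h x0" if "b \<ge> x0" for b
  proof (rule DERIV_nonpos_imp_nonincreasing[OF that])
    fix x assume "x0 \<le> x" "x \<le> b"
    then have "(h has_real_derivative ((\<Sum>f\<leftarrow>fs. 1 / (x + f)) - (\<Sum>e\<leftarrow>es. 1 / (x + e)))) (at x)"
      unfolding h_def by (intro DERIV_diff has_derivative_sum_ln pos) auto
    with le[OF \<open>x0 \<le> x\<close>] show "\<exists>y. (h has_real_derivative y) (at x) \<and> y \<le> 0"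
      by (intro exI conjI) auto
  qed
  have "(h \<longlongrightarrow> 0 - 0) at_top"
    using tendsto_diff[OF sum_ln_asymp[of fs] sum_ln_asymp[of es]] by (simp add: h_def len)
  then have "0 - 0 \<le> h x0"
    by (rule tendsto_upperbound) (auto intro!: mono eventually_at_top_linorderI[of x0])
  moreover have es0: "(\<Prod>e\<leftarrow>es. x0 + e) > 0 \<and> ln (\<Prod>e\<leftarrow>es. x0 + e) = (\<Sum>e\<leftarrow>es. ln (x0 + e))"
    by (rule ln_prod_list_add) (simp add: pos)
  moreover have fs0: "(\<Prod>f\<leftarrow>fs. x0 + f) > 0 \<and> ln (\<Prod>f\<leftarrow>fs. x0 + f) = (\<Sum>f\<leftarrow>fs. ln (x0 + f))"
    by (rule ln_prod_list_add) (simp add: pos)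
  ultimately have "ln (\<Prod>e\<leftarrow>es. x0 + e) \<le> ln (\<Prod>f\<leftarrow>fs. x0 + f)"
    by (simp add: h_def)
  then show ?thesis using es0 fs0 ln_le_cancel_iff by blast
qed

section \<open>Connected graphs with as many edges as vertices\<close>

lemma connected_design_binary: "connected_design v E \<Longrightarrow> binary_design v E"
  by (simp add: connected_design_def)

lemma connected_design_reach:
  assumes "connected_design v E" "i < v" "j < v"
  shows "(i, j) \<in> {(a, b). {a, b} \<in># E}\<^sup>*"
  using assms by (simp add: connected_design_def)

text \<open>Each vertex other than 0 is charged to the last edge of a shortest path from 0.\<close>
lemma connected_design_card_edges:
  assumes c: "connected_design v E"
  shows "v - 1 \<le> card (set_mset E)"
proof (cases "v = 0")
  case False
  define R where "R = {(a, b). {a, b} \<in># E}"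
  define d where "d = (\<lambda>i. LEAST n. (0, i) \<in> R ^^ n)"
  have "\<exists>p. (p, i) \<in> R \<and> d p < d i" if i: "i \<in> {1..<v}" for i
  proof -
    have "(0, i) \<in> R\<^sup>*" using connected_design_reach[OF c, of 0 i] i by (simp add: R_def)
    then obtain n where "(0, i) \<in> R ^^ n" using rtrancl_imp_relpow by blast
    then have di: "(0, i) \<in> R ^^ d i" unfolding d_def by (rule LeastI)
    then have "d i \<noteq> 0" using i by (intro notI) simp
    then obtain m where m: "d i = Suc m" by (cases "d i") auto
    with di obtain p where p: "(0, p) \<in> R ^^ m" "(p, i) \<in> R" by auto
    then have "d p \<le> m" unfolding d_def by (intro Least_le)
    with p m show ?thesis by auto
  qed
  then obtain p where p: "\<And>i. i \<in> {1..<v} \<Longrightarrow> (p i, i) \<in> R \<and> d (p i) < d i" by metis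
  \<comment> \<open>If distinct \<open>i\<close> and \<open>j\<close> shared an edge, each would be
    the parent of the other, and \<open>d\<close> would strictly decrease both ways.\<close>
  have "inj_on (\<lambda>i. {p i, i}) {1..<v}"
  proof (rule inj_onI)
    fix i j assume "i \<in> {1..<v}" "j \<in> {1..<v}" "{p i, i} = {p j, j}"
    then show "i = j" using p[of i] p[of j] by (auto simp: doubleton_eq_iff)
  qed
  moreover have "(\<lambda>i. {p i, i}) ` {1..<v} \<subseteq> set_mset E" using p by (auto simp: R_def)
  ultimately have "card {1..<v} \<le> card (set_mset E)" by (intro card_inj_on_le) auto
  then show ?thesis by simp
qed simp

text \<open>At least v - 1 of the v blocks are distinct by connectedness, so the multiplicities
  exceed 1 by at most 1 in total.\<close>

lemma unicyclic_multiplicities: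
  assumes c: "connected_design v E" and s: "size E = v" and "count E e0 \<ge> 2"
  shows "count E e0 = 2" "e \<noteq> e0 \<Longrightarrow> count E e \<le> 1"
proof -
  have "(\<Sum>e\<in>set_mset E. count E e - 1) + card (set_mset E) = (\<Sum>e\<in>set_mset E. count E e)"
    unfolding card_eq_sum sum.distrib[symmetric] by (intro sum.cong) (auto simp: Suc_leI)
  also have "\<dots> = v" using s by (simp add: size_multiset_overloaded_eq)
  finally have *: "(\<Sum>e\<in>set_mset E. count E e - 1) \<le> 1"
    using connected_design_card_edges[OF c] by simp
  have e0: "e0 \<in># E" using assms(3) by (simp flip: count_greater_zero_iff)
  have split: "(\<Sum>e\<in>set_mset E. count E e - 1) = (count E e0 - 1) + (\<Sum>e\<in>set_mset E - {e0}. count E e - 1)"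
    using e0 by (intro sum.remove) auto
  then show "count E e0 = 2" using * assms(3) by simp
  show "count E e \<le> 1" if "e \<noteq> e0"
  proof (cases "e \<in># E")
    case True
    have "count E e - 1 \<le> (\<Sum>e\<in>set_mset E - {e0}. count E e - 1)"
      using True that by (intro member_le_sum) auto
    then show ?thesis using * split assms(3) by simp
  qed (simp add: not_in_iff)
qed

lemma connected_design_degree_pos:
  assumes c: "connected_design v E" and "v \<ge> 2" "i < v"
  shows "degree_in E i \<ge> 1"
proof -
  define j where "j = (if i = 0 then 1 else 0 :: nat)"
  have j: "j < v" "j \<noteq> i" using assms by (auto simp: j_def)
  obtain k where "{i, k} \<in># E"
    using connected_design_reach[OF c assms(3) j(1)] j(2) by (auto elim: converse_rtranclE)
  then have "{i, k} \<in># filter_mset (\<lambda>e. i \<in> e) E" by simp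
  then have "filter_mset (\<lambda>e. i \<in> e) E \<noteq> {#}" by auto
  then show ?thesis unfolding degree_in_def by (metis One_nat_def Suc_leI nonempty_has_size)
qed

text \<open>Only a copy of the block \<open>{p, q}\<close> can contribute to both degrees.\<close>

lemma degree_in_add_le:
  assumes "binary_design v E" "p \<noteq> q"
  shows "degree_in E p + degree_in E q \<le> size E + count E {p, q}"
  using assms(1)
proof (induction E)
  case (add e E)
  then have e: "card e = 2" and E: "binary_design v E" by (auto simp: binary_design_def)
  have "e = {p, q}" if "p \<in> e" "q \<in> e" using that e assms(2) by (auto simp: card_2_iff)
  then have "(if p \<in> e then 1 else 0) + (if q \<in> e then 1 else 0) \<le> 1 + (if e = {p, q} then 1 else 0 :: nat)"
    by (cases "p \<in> e"; cases "q \<in> e") simp_all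
  moreover have "degree_in (add_mset e E) x = degree_in E x + (if x \<in> e then 1 else 0)" for x
    by (simp add: degree_in_def)
  moreover have "count (add_mset e E) {p, q} = count E {p, q} + (if e = {p, q} then 1 else 0)"
    by simp
  ultimately show ?case using add.IH[OF E] by (simp only: size_add_mset)
qed (simp add: degree_in_def)

lemma real_degree_in:
  assumes "binary_design v E" "i < v"
  shows "(\<Sum>j<v. multiplicity_in E i j) = real (degree_in E i)"
  by (simp add: degree_in_eq_sum[OF assms])

lemma simple_design_degree_le:
  assumes b: "binary_design v E" and "\<And>e. count E e \<le> 1" "i < v"
  shows "degree_in E i \<le> v - 1"
proof -
  have "(\<Sum>j<v. count E {i, j}) = (\<Sum>j\<in>{..<v} - {i}. count E {i, j})"
    using assms by (subst sum.remove[of _ i]) auto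
  also have "\<dots> \<le> (\<Sum>j\<in>{..<v} - {i}. 1)" by (intro sum_mono assms)
  finally show ?thesis using assms(3) by (simp add: degree_in_eq_sum[OF b])
qed

text \<open>The left-hand side of the assumption \<open>gap\<close> of \<open>sum_inverse_le\<close>, with the power sums of the
  eigenvalues replaced by the traces in \<open>weighted_laplacian_moments\<close>.\<close>
definition spectral_gap :: "nat \<Rightarrow> nat set multiset \<Rightarrow> real \<Rightarrow> real" where
  "spectral_gap v E a = (let w = multiplicity_in E; d = \<lambda>i. real (degree_in E i) - 2 in
     ((\<Sum>i<v. (d i)\<^sup>2) + (\<Sum>i<v. \<Sum>j<v. (w i j)\<^sup>2) - 2 * real v) * a
     - ((\<Sum>i<v. (d i) ^ 3) + 3 * (\<Sum>i<v. d i * (\<Sum>j<v. (w i j)\<^sup>2))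
        - (\<Sum>i<v. \<Sum>j<v. \<Sum>k<v. w i j * w j k * w k i)))"

text \<open>Since the \<open>d i\<close> sum to zero, \<open>d i\<close> may be added to each summand of the lower bound.\<close>
lemma spectral_gap_ge:
  assumes b: "binary_design v E" and s: "size E = v"
    and r: "\<And>i. i < v \<Longrightarrow> (\<Sum>j<v. (multiplicity_in E i j)\<^sup>2) = real (degree_in E i) + r i"
  defines "d \<equiv> \<lambda>i. real (degree_in E i) - 2"
  shows "spectral_gap v E a \<ge> (\<Sum>i<v. (d i)\<^sup>2 * (a - 3 - d i) + d i) + (\<Sum>i<v. r i * (a - 3 * d i))"
proof -
  let ?w = "multiplicity_in E"
  have sd: "(\<Sum>i<v. real (degree_in E i)) = 2 * real v"
    using sum_degree_in[OF b] s by (simp flip: of_nat_sum)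
  then have d0: "(\<Sum>i<v. d i) = 0" by (simp add: d_def sum_subtractf)
  have q: "(\<Sum>i<v. \<Sum>j<v. (?w i j)\<^sup>2) = 2 * real v + (\<Sum>i<v. r i)"
    using r sd by (simp add: sum.distrib)
  have dq: "(\<Sum>i<v. d i * (\<Sum>j<v. (?w i j)\<^sup>2)) = (\<Sum>i<v. (d i)\<^sup>2) + (\<Sum>i<v. d i * r i)"
  proof -
    \<comment> \<open>The degree is \<open>d i + 2\<close>; the resulting linear term 2 d i
      disappears on summation.\<close>
    have "(\<Sum>i<v. d i * (\<Sum>j<v. (?w i j)\<^sup>2)) = (\<Sum>i<v. (d i)\<^sup>2 + 2 * d i + d i * r i)"
      using r by (intro sum.cong) (auto simp: d_def power2_eq_square algebra_simps)
    then show ?thesis using d0 by (simp add: sum.distrib flip: sum_distrib_left)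
  qed
  \<comment> \<open>Closed 3-walks enter the gap with a positive sign, so a lower bound may drop
    them.\<close>
  have t: "(\<Sum>i<v. \<Sum>j<v. \<Sum>k<v. ?w i j * ?w j k * ?w k i) \<ge> 0"
    by (intro sum_nonneg) auto
  have "(\<Sum>i<v. (d i)\<^sup>2 * (a - 3 - d i) + d i) + (\<Sum>i<v. r i * (a - 3 * d i))
     = (\<Sum>i<v. (d i)\<^sup>2 * a - 3 * (d i)\<^sup>2 - (d i) ^ 3 + d i) + (\<Sum>i<v. r i * a - 3 * (d i * r i))"
    by (intro arg_cong2[of _ _ _ _ "(+)"] sum.cong refl) (auto simp: power2_eq_square power3_eq_cube algebra_simps)
  also have "\<dots> = ((\<Sum>i<v. (d i)\<^sup>2) + (\<Sum>i<v. r i)) * a - (\<Sum>i<v. (d i) ^ 3)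
      - 3 * ((\<Sum>i<v. (d i)\<^sup>2) + (\<Sum>i<v. d i * r i))"
    using d0 by (simp add: sum.distrib sum_subtractf sum_distrib_left sum_distrib_right algebra_simps)
  finally have eq: "(\<Sum>i<v. (d i)\<^sup>2 * (a - 3 - d i) + d i) + (\<Sum>i<v. r i * (a - 3 * d i)) = \<dots>" .
  have "spectral_gap v E a = ((\<Sum>i<v. (d i)\<^sup>2) + (\<Sum>i<v. \<Sum>j<v. (?w i j)\<^sup>2) - 2 * real v) * a
     - ((\<Sum>i<v. (d i) ^ 3) + 3 * (\<Sum>i<v. d i * (\<Sum>j<v. (?w i j)\<^sup>2))
        - (\<Sum>i<v. \<Sum>j<v. \<Sum>k<v. ?w i j * ?w j k * ?w k i))"
    unfolding spectral_gap_def Let_def d_def ..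
  then show ?thesis unfolding eq q dq using t by simp
qed

text \<open>Every vertex of degree other than 2 contributes at least \<open>a - 3\<close>, and since
  the \<open>d i\<close> sum to zero there are at least two of them. For v = 3 all
  \<open>d i\<close> are at most 0, hence zero, which contradicts \<open>nr\<close>.\<close>

lemma spectral_gap_simple:
  assumes c: "connected_design v E" and s: "size E = v" and v: "v \<ge> 3" and a: "a \<ge> real v + 2"
    and simple: "\<And>e. count E e \<le> 1" and nr: "i0 < v" "degree_in E i0 \<noteq> 2"
  shows "v \<ge> 4 \<and> spectral_gap v E a \<ge> 2 * (a - 3)"
proof -
  note b = connected_design_binary[OF c]
  define d where "d = (\<lambda>i. real (degree_in E i) - 2)"
  define g where "g = (\<lambda>i. (d i)\<^sup>2 * (a - 3 - d i) + d i)"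
  have sq: "(multiplicity_in E i j)\<^sup>2 = multiplicity_in E i j" for i j
    using simple[of "{i, j}"] by (cases "count E {i, j}") auto
  have gap: "spectral_gap v E a \<ge> (\<Sum>i<v. g i)"
    using spectral_gap_ge[OF b s, of "\<lambda>_. 0" a] by (simp add: sq real_degree_in[OF b] d_def g_def)
  have upper: "d i \<le> real v - 3" if "i < v" for i
    using simple_design_degree_le[OF b simple that] v by (simp add: d_def)
  have g: "g i \<ge> 0 \<and> (d i \<noteq> 0 \<longrightarrow> g i \<ge> a - 3)" if i: "i < v" for i
  proof -
    have "degree_in E i \<ge> 1" using connected_design_degree_pos[OF c _ i] v by simp
    then consider "d i = -1" | "d i = 0" | "d i \<ge> 1" unfolding d_def by force
    then show ?thesis
    proof cases
      case 3
      have c0: "a - 3 - d i \<ge> 0" using upper[OF i] a by simp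
      \<comment> \<open>Here the added summand \<open>d i\<close> pays off: it cancels the
        \<open>- d i\<close> in this bound and leaves exactly \<open>a - 3\<close>.\<close>
      have "1 * (a - 3 - d i) \<le> (d i)\<^sup>2 * (a - 3 - d i)"
        using 3 c0 by (intro mult_right_mono) auto
      then show ?thesis using c0 3 by (simp add: g_def)
    qed (use a v in \<open>auto simp: g_def\<close>)
  qed
  have "(\<Sum>i<v. real (degree_in E i)) = 2 * real v"
    using sum_degree_in[OF b] s by (simp flip: of_nat_sum)
  then have d0: "(\<Sum>i<v. d i) = 0" by (simp add: d_def sum_subtractf)
  have i0: "d i0 \<noteq> 0" using nr(2) by (simp add: d_def)
  have rest: "d i0 + (\<Sum>i\<in>{..<v} - {i0}. d i) = 0"
    using d0 nr(1) by (subst (asm) sum.remove[of _ i0]) auto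
  then have "(\<Sum>i\<in>{..<v} - {i0}. d i) \<noteq> 0" using i0 by simp
  then obtain i1 where i1: "i1 < v" "i1 \<noteq> i0" "d i1 \<noteq> 0"
    by (metis (no_types, lifting) DiffE lessThan_iff singletonI sum.not_neutral_contains_not_neutral)
  have "(\<Sum>i\<in>{i0, i1}. g i) \<le> (\<Sum>i<v. g i)"
    using nr(1) i1 g by (intro sum_mono2) auto
  moreover have "(\<Sum>i\<in>{i0, i1}. g i) \<ge> 2 * (a - 3)"
    using g[OF nr(1)] g[OF i1(1)] i0 i1 by simp
  moreover have "v \<ge> 4"
  proof (rule ccontr)
    assume "\<not> v \<ge> 4"
    then have "\<And>i. i < v \<Longrightarrow> d i \<le> 0" using upper by force
    moreover have "d i0 < 0" using i0 calculation[OF nr(1)] by simp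
    ultimately have "(\<Sum>i<v. - d i) > 0" using nr(1) by (intro sum_pos2[of _ i0]) auto
    with d0 show False by (simp add: sum_negf)
  qed
  ultimately show ?thesis using gap by linarith
qed

text \<open>The squared multiplicity 4 exceeds the multiplicity 2 by 2 in the rows of both ends
  \<open>p\<close> and \<open>q\<close>, which yields the main term 4 a - 6 (d p + d q). The loss is
  compensated by the terms \<open>g p\<close> and \<open>g q\<close> and by the bound on the degree
  sum of \<open>p\<close> and \<open>q\<close>.\<close>

lemma spectral_gap_double_edge:
  assumes c: "connected_design v E" and s: "size E = v" and v: "v \<ge> 3" and a: "a \<ge> real v + 2"
    and double: "count E e0 \<ge> 2"
  shows "spectral_gap v E a \<ge> 15"
proof -
  note b = connected_design_binary[OF c]
  have "e0 \<in># E" using double by (simp flip: count_greater_zero_iff)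
  then have "e0 \<subseteq> {..<v}" "card e0 = 2" using b by (auto simp: binary_design_def)
  then obtain p q where pq: "e0 = {p, q}" "p \<noteq> q" "p < v" "q < v" by (auto simp: card_2_iff)
  note mult = unicyclic_multiplicities[OF c s double]
  define d where "d = (\<lambda>i. real (degree_in E i) - 2)"
  define g where "g = (\<lambda>i. (d i)\<^sup>2 * (a - 3 - d i) + d i)"
  define r where "r = (\<lambda>i. if i = p \<or> i = q then 2 else 0 :: real)"
  have r: "(\<Sum>j<v. (multiplicity_in E i j)\<^sup>2) = real (degree_in E i) + r i" if i: "i < v" for i
  proof -
    have "(multiplicity_in E i j)\<^sup>2 = multiplicity_in E i j +
        ((if j = q then if i = p then 2 else 0 else 0) + (if j = p then if i = q then 2 else 0 else 0))" for j
    proof (cases "{i, j} = e0")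
      case True
      then have "count E {i, j} = 2" using mult(1) by simp
      moreover have "i = p \<and> j = q \<or> i = q \<and> j = p"
        using True unfolding pq(1) by (auto simp: doubleton_eq_iff)
      ultimately show ?thesis using pq(2) by (elim disjE) simp_all
    next
      case False
      then have "count E {i, j} \<le> 1" by (rule mult(2))
      then have "count E {i, j} = 0 \<or> count E {i, j} = 1" by auto
      moreover have "\<not> (i = p \<and> j = q)" "\<not> (i = q \<and> j = p)"
        using False unfolding pq(1) by (auto simp: insert_commute)
      ultimately show ?thesis by auto
    qed
    then have "(\<Sum>j<v. (multiplicity_in E i j)\<^sup>2) = (\<Sum>j<v. multiplicity_in E i j) +
       ((if i = p then 2 else 0) + (if i = q then 2 else 0))"
      using pq by (simp add: sum.distrib)
    then show ?thesis using real_degree_in[OF b i] pq(2) by (auto simp: r_def)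
  qed
  have "(\<Sum>i<v. r i * (a - 3 * d i)) = (\<Sum>i\<in>{p, q}. 2 * (a - 3 * d i))"
    using pq by (intro sum.mono_neutral_cong_right) (auto simp: r_def)
  then have rs: "(\<Sum>i<v. r i * (a - 3 * d i)) = 4 * a - 6 * (d p + d q)"
    using pq by simp
  have gap: "spectral_gap v E a \<ge> (\<Sum>i<v. g i) + (4 * a - 6 * (d p + d q))"
    using spectral_gap_ge[OF b s r, of a] rs by (simp add: d_def g_def)
  have upper: "d i \<le> real v - 2" for i
    using s size_filter_mset_lesseq[of "\<lambda>e. i \<in> e" E] by (simp add: d_def degree_in_def)
  have g: "g i \<ge> 0" "d i \<ge> 0 \<Longrightarrow> g i \<ge> (d i)\<^sup>2 + d i" if i: "i < v" for i
  proof -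
    have c0: "a - 3 - d i \<ge> 1" using upper[of i] a by simp
    show g2: "g i \<ge> (d i)\<^sup>2 + d i" if "d i \<ge> 0"
      using mult_left_mono[OF c0, of "(d i)\<^sup>2"] by (simp add: g_def)
    have "degree_in E i \<ge> 1" using connected_design_degree_pos[OF c _ i] v by simp
    then consider "d i = -1" | "d i \<ge> 0" unfolding d_def by force
    then show "g i \<ge> 0"
    proof cases
      case 1
      then show ?thesis using a v by (simp add: g_def)
    next
      case 2
      then have "0 \<le> (d i)\<^sup>2 + d i" by simp
      with g2[OF 2] show ?thesis by linarith
    qed
  qed
  have deg2: "degree_in E i \<ge> 2" if "e0 \<subseteq> {i, j}" "i < v" "j < v" "i \<in> e0" "j \<in> e0" for i j
  proof -
    have "count E {i, j} \<le> (\<Sum>j<v. count E {i, j})" using that by (intro member_le_sum) auto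
    moreover have "{i, j} = e0" using that by auto
    ultimately show ?thesis using double that by (simp add: degree_in_eq_sum[OF b])
  qed
  have dp: "d p \<ge> 0" and dq: "d q \<ge> 0" using deg2[of p q] deg2[of q p] pq by (auto simp: d_def)
  have "degree_in E p + degree_in E q \<le> v + 2"
    using degree_in_add_le[OF b pq(2)] s mult(1) pq(1) by simp
  then have dpq: "d p + d q \<le> real v - 2" by (simp add: d_def)
  have "g p + g q = (\<Sum>i\<in>{p, q}. g i)" using pq by simp
  also have "\<dots> \<le> (\<Sum>i<v. g i)" using pq g(1) by (intro sum_mono2) auto
  finally have "(\<Sum>i<v. g i) \<ge> (d p)\<^sup>2 + d p + ((d q)\<^sup>2 + d q)"
    using g(2)[OF pq(3) dp] g(2)[OF pq(4) dq] by linarith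
  \<comment> \<open>Writing d^2 + d - 6 d as (d^2 - d) - 4 d leaves 4 a - 4 (d p + d q) - 1/2. As d
    p + d q is at most v - 2, hence at most a - 4, this is at least 16 - 1/2.\<close>
  moreover have "(d p)\<^sup>2 - d p \<ge> - 1 / 4" "(d q)\<^sup>2 - d q \<ge> - 1 / 4"
    using zero_le_power2[of "d p - 1 / 2"] zero_le_power2[of "d q - 1 / 2"]
    by (simp_all add: power2_eq_square algebra_simps)
  ultimately show ?thesis using gap dpq a by simp
qed

section \<open>Recognising the cycle among simple 2-regular graphs\<close>

lemma char_poly_permuted:
  fixes A B :: "'a::field mat"
  assumes A: "A \<in> carrier_mat n n" and B: "B \<in> carrier_mat n n" and f: "bij_betw f {..<n} {..<n}"
    and ent: "\<And>i j. i < n \<Longrightarrow> j < n \<Longrightarrow> B $$ (i, j) = A $$ (f i, f j)"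
  shows "char_poly B = char_poly A"
proof -
  \<comment> \<open>The permutation matrix of \<open>f\<close>, whose inverse is its transpose;
    conjugating \<open>A\<close> by it gives \<open>B\<close>.\<close>
  define P where "P = mat n n (\<lambda>(i, k). if k = f i then 1 else 0 :: 'a)"
  let ?Q = "transpose_mat P"
  have f: "f i < n" if "i < n" for i using bij_betwE[OF f] that by auto
  have inj: "f i = f j \<longleftrightarrow> i = j" if "i < n" "j < n" for i j
    using bij_betw_imp_inj_on[OF \<open>bij_betw f {..<n} {..<n}\<close>] that by (auto simp: inj_on_eq_iff)
  have car: "P \<in> carrier_mat n n" "?Q \<in> carrier_mat n n" by (auto simp: P_def)
  have PM: "(P * M) $$ (i, j) = M $$ (f i, j)" if "M \<in> carrier_mat n n" "i < n" "j < n" for M i j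
  proof -
    have "(P * M) $$ (i, j) = (\<Sum>k<n. if k = f i then M $$ (f i, j) else 0)"
      unfolding index_mult_mat_sum[OF car(1) that] using that by (intro sum.cong) (auto simp: P_def)
    then show ?thesis using f[OF that(2)] by simp
  qed
  have PQ: "P * ?Q = 1\<^sub>m n"
    using car by (intro eq_matI) (auto simp: PM f inj simp del: index_mult_mat(1), auto simp: P_def f inj)
  have Q: "?Q $$ (k, j) = (if k = f j then 1 else 0)" if "k < n" "j < n" for k j
    using that by (simp add: P_def)
  have "P * A * ?Q = B"
  proof (rule eq_matI)
    fix i j assume "i < dim_row B" "j < dim_col B"
    then have ij: "i < n" "j < n" using B by auto
    have "(P * A * ?Q) $$ (i, j) = (\<Sum>k<n. if k = f j then A $$ (f i, f j) else 0)"
      unfolding index_mult_mat_sum[OF mult_carrier_mat[OF car(1) A] car(2) ij] using ij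
      by (intro sum.cong) (auto simp: PM[OF A] Q simp del: index_mult_mat(1) index_transpose_mat(1))
    then show "(P * A * ?Q) $$ (i, j) = B $$ (i, j)" using f[OF ij(2)] by (simp add: ent[OF ij])
  qed (use car B in auto)
  then have "similar_mat B A"
    using car A B PQ mat_mult_left_right_inverse[OF car PQ] by (intro similar_matI[of _ _ P ?Q n]) auto
  then show ?thesis by (rule char_poly_similar)
qed

lemma count_Cycle:
  assumes v: "v \<ge> 3" and ij: "i < v" "j < v"
  shows "count (Cycle v) {i, j} = (if j = Suc i mod v then 1 else 0) + (if i = Suc j mod v then 1 else 0)"
proof -
  have "count (Cycle v) {i, j} = (\<Sum>k<v. if {k, Suc k mod v} = {i, j} then 1 else 0)"
    by (simp add: Cycle_def count_image_mset_sum)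
  also have "\<dots> = (\<Sum>k<v. (if k = i then if j = Suc i mod v then 1 else 0 else 0) + (if k = j then if i = Suc j mod v then 1 else 0 else 0))"
    using v ij by (intro sum.cong refl) (auto simp: doubleton_eq_iff mod_Suc split: if_splits)
  finally show ?thesis using ij by (simp add: sum.distrib)
qed

lemma char_poly_laplacian_relabelled_cycle:
  assumes v: "v \<ge> 3" and f: "bij_betw f {..<v} {..<v}" and b: "binary_design v E"
    and E: "E = image_mset (\<lambda>k. {f k, f (Suc k mod v)}) (mset_set {..<v})"
  shows "char_poly (laplacian v E) = char_poly (laplacian v (Cycle v))"
proof -
  note bC = binary_design_Cycle[OF v]
  have fv: "f i < v" if "i < v" for i using bij_betwE[OF f] that by auto
  have inj: "f i = f j \<longleftrightarrow> i = j" if "i < v" "j < v" for i j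
    using bij_betw_imp_inj_on[OF f] that by (auto simp: inj_on_eq_iff)
  have cnt: "multiplicity_in E (f i) (f j) = multiplicity_in (Cycle v) i j" if "i < v" "j < v" for i j
    using that v by (auto simp: E Cycle_def count_image_mset_sum inj doubleton_eq_iff intro!: sum.cong)
  have "char_poly (weighted_laplacian v (multiplicity_in (Cycle v))) = char_poly (weighted_laplacian v (multiplicity_in E))"
  proof (rule char_poly_permuted[OF weighted_laplacian_carrier weighted_laplacian_carrier f])
    fix i j assume ij: "i < v" "j < v"
    have "(\<Sum>k<v. multiplicity_in E (f i) k) = (\<Sum>k<v. multiplicity_in E (f i) (f k))"
      by (rule sum.reindex_bij_betw[OF f, symmetric])
    also have "\<dots> = (\<Sum>k<v. multiplicity_in (Cycle v) i k)" using ij by (simp add: cnt)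
    finally have "(\<Sum>k<v. multiplicity_in E (f i) k) = (\<Sum>k<v. multiplicity_in (Cycle v) i k)" .
    then show "weighted_laplacian v (multiplicity_in (Cycle v)) $$ (i, j)
        = weighted_laplacian v (multiplicity_in E) $$ (f i, f j)"
      using ij fv[OF ij(1)] fv[OF ij(2)] inj[OF ij] cnt[OF ij]
      by (cases "i = j") (simp_all add: weighted_laplacian_def)
  qed
  then show ?thesis by (simp add: laplacian_eq_weighted b bC)
qed

text \<open>A path of maximal length in a 2-regular simple graph closes up to a cycle, which
  is a connected component.\<close>
lemma regular_simple_connected_is_cycle:
  assumes c: "connected_design v E" and s: "size E = v" and v: "v \<ge> 3"
    and simple: "\<And>e. count E e \<le> 1" and reg: "\<And>i. i < v \<Longrightarrow> degree_in E i = 2"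
  obtains f where "bij_betw f {..<v} {..<v}" "E = image_mset (\<lambda>k. {f k, f (Suc k mod v)}) (mset_set {..<v})"
proof -
  note b = connected_design_binary[OF c]
  define N where "N = (\<lambda>i. {j. {i, j} \<in># E})"
  have NE: "j \<in> N i \<longleftrightarrow> {i, j} \<in># E" for i j by (simp add: N_def)
  have Nsym: "j \<in> N i \<longleftrightarrow> i \<in> N j" for i j by (simp add: NE insert_commute)
  have Nv: "i < v" "j < v" "i \<noteq> j" if "j \<in> N i" for i j
  proof -
    have "{i, j} \<subseteq> {..<v}" "card {i, j} = 2" using b that by (auto simp: NE binary_design_def)
    then show "i < v" "j < v" "i \<noteq> j" by auto
  qed
  have cardN: "card (N i) = 2" if "i < v" for i
  proof -
    have "degree_in E i = (\<Sum>j<v. if j \<in> N i then 1 else 0)"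
      unfolding degree_in_eq_sum[OF b that]
    proof (intro sum.cong refl)
      fix j
      show "count E {i, j} = (if j \<in> N i then 1 else 0)"
        using simple[of "{i, j}"] by (cases "{i, j} \<in># E") (auto simp: NE not_in_iff le_Suc_eq simp flip: count_greater_zero_iff)
    qed
    also have "\<dots> = card (N i)" by (auto simp: sum.If_cases intro!: arg_cong[of _ _ card] dest: Nv(2))
    finally show ?thesis using reg[OF that] by simp
  qed
  have finN: "finite (N i)" for i by (rule finite_subset[of _ "{..<v}"]) (auto dest: Nv(2))
  have N3: "False" if "{x, y, z} \<subseteq> N i" "distinct [x, y, z]" for i x y z
  proof -
    have "card {x, y, z} \<le> card (N i)" using that finN by (intro card_mono) auto
    moreover have "i < v" using that Nv[of x i] by auto
    ultimately show False using that cardN[of i] by auto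
  qed
  define path where "path = (\<lambda>xs. distinct xs \<and> set xs \<subseteq> {..<v} \<and> (\<forall>i. Suc i < length xs \<longrightarrow> xs ! Suc i \<in> N (xs ! i)))"
  have len_le: "length xs \<le> v" if "path xs" for xs
    using that card_mono[of "{..<v}" "set xs"] by (auto simp: path_def distinct_card)
  \<comment> \<open>Vertex 0 with its two neighbours is a path of three vertices, so a longest path
    has at least three.\<close>
  obtain n1 n2 where n12: "N 0 = {n1, n2}" "n1 \<noteq> n2" using cardN[of 0] v by (auto simp: card_2_iff)
  have p3: "path [n1, 0, n2]"
    using n12 Nv[of n1 0] Nv[of n2 0] Nsym[of 0 n1] by (auto simp: path_def less_Suc_eq nth_Cons split: nat.splits)
  obtain xs where xs: "path xs" and max: "\<And>ys. path ys \<Longrightarrow> length ys \<le> length xs"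
    using ex_has_greatest_nat[of path "[n1, 0, n2]" length "Suc v"] p3 len_le by (auto simp: less_Suc_eq_le)
  define k where "k = length xs"
  have k3: "k \<ge> 3" using max[OF p3] by (simp add: k_def)
  have dist: "xs ! i = xs ! j \<longleftrightarrow> i = j" if "i < k" "j < k" for i j
    using xs that by (simp add: path_def nth_eq_iff_index_eq k_def)
  have xv: "xs ! i < v" if "i < k" for i using xs that by (auto simp: path_def k_def dest: nth_mem)
  have step: "xs ! Suc i \<in> N (xs ! i)" if "Suc i < k" for i using xs that by (simp add: path_def k_def)
  define l where "l = xs ! (k - 1)"
  have l: "l < v" using xv[of "k - 1"] k3 by (simp add: l_def)
  have prev: "xs ! (k - 2) \<in> N l"
    using step[of "k - 2"] k3 by (simp add: l_def Nsym numeral_2_eq_2 Suc_diff_Suc)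
  \<comment> \<open>The second neighbour of the last vertex \<open>l\<close>. By maximality it
    cannot extend the path, so it already lies on it.\<close>
  obtain y where y: "y \<in> N l" "y \<noteq> xs ! (k - 2)"
    using cardN[OF l] prev by (auto simp: card_2_iff)
  have "y \<in> set xs"
  proof (rule ccontr)
    assume "y \<notin> set xs"
    moreover have "xs ! i = l" if "Suc i = length xs" for i
      unfolding l_def k_def that[symmetric] by simp
    ultimately have "path (xs @ [y])"
      using xs y(1) Nv(2)[OF y(1)] by (auto simp: path_def nth_append less_Suc_eq)
    from max[OF this] show False by simp
  qed
  then obtain i where i: "i < k" "y = xs ! i" by (auto simp: in_set_conv_nth k_def)
  \<comment> \<open>An interior vertex of the path adjacent to \<open>l\<close> would have three
    neighbours: its two neighbours on the path and \<open>l\<close>. The positions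
    \<open>k - 1\<close> and \<open>k - 2\<close> are excluded by looplessness and by the choice of
    \<open>y\<close>.\<close>
  have "i = 0"
  proof (rule ccontr)
    assume "i \<noteq> 0"
    moreover have "i \<noteq> k - 1" using i Nv(3)[OF y(1)] by (auto simp: l_def)
    moreover have "i \<noteq> k - 2" using i y(2) by auto
    ultimately have i': "0 < i" "Suc i < k - 1" using i by auto
    have "xs ! (i - 1) \<in> N y" using step[of "i - 1"] i' i by (simp add: Nsym)
    moreover have "xs ! Suc i \<in> N y" using step[of i] i' i by simp
    moreover have "l \<in> N y" using y(1) by (simp add: Nsym)
    moreover have "distinct [i - 1, Suc i, k - 1]" using i' by auto
    then have "distinct [xs ! (i - 1), xs ! Suc i, l]" using i' by (simp add: l_def dist)
    ultimately show False using N3[of "xs ! (i - 1)" "xs ! Suc i" l y] by simp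
  qed
  then have close: "xs ! 0 \<in> N l" using i y by simp
  have next_in: "xs ! (Suc i mod k) \<in> N (xs ! i)" if "i < k" for i
    using step[of i] close that by (cases "Suc i = k") (auto simp: l_def)
  \<comment> \<open>The cyclic successor and predecessor are already both neighbours of
    \<open>xs ! i\<close>. Hence the path is closed under adjacency and, by connectedness, contains
    every vertex.\<close>
  have nbrs: "N (xs ! i) \<subseteq> set xs" if i: "i < k" for i
  proof -
    define j where "j = (if i = 0 then k - 1 else i - 1)"
    have j: "j < k" "Suc j mod k = i" using i by (auto simp: j_def)
    have a: "xs ! (Suc i mod k) \<in> N (xs ! i)" "xs ! j \<in> N (xs ! i)"
      using next_in[OF i] next_in[OF j(1)] j(2) by (auto simp: Nsym)
    have "Suc i mod k \<noteq> j" using i k3 by (auto simp: j_def mod_Suc)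
    then have ne: "xs ! (Suc i mod k) \<noteq> xs ! j" using j(1) k3 by (simp add: dist)
    have "N (xs ! i) = {xs ! (Suc i mod k), xs ! j}"
      using a ne cardN[OF xv[OF i]] finN by (intro card_seteq[symmetric]) auto
    moreover have "Suc i mod k < k" using k3 by simp
    ultimately show ?thesis using j(1) by (auto simp: k_def intro: nth_mem)
  qed
  have "j \<in> set xs" if "j < v" for j
  proof -
    have "(xs ! 0, j) \<in> {(a, b). {a, b} \<in># E}\<^sup>*"
      using connected_design_reach[OF c _ that] xv[of 0] k3 by simp
    then show ?thesis
    proof (induction rule: rtrancl_induct)
      case base
      have "0 < length xs" using k3 unfolding k_def by linarith
      then show ?case by (rule nth_mem)
    next
      case (step y z)
      then obtain i where i: "i < k" "y = xs ! i" by (auto simp: in_set_conv_nth k_def)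
      have "z \<in> N (xs ! i)" using step.hyps(2) i(2) by (simp add: NE)
      then show ?case using nbrs[OF i(1)] by blast
    qed
  qed
  then have set: "set xs = {..<v}" using xs by (auto simp: path_def)
  then have k: "k = v" using xs distinct_card[of xs] by (simp add: path_def k_def)
  let ?g = "\<lambda>i. {xs ! i, xs ! (Suc i mod v)}"
  have bij: "bij_betw ((!) xs) {..<v} {..<v}"
    using xs k set by (intro bij_betw_nth) (auto simp: path_def k_def)
  \<comment> \<open>Two equal edges with different indices would make \<open>i\<close> and
    \<open>j\<close> cyclic successors of each other, impossible for v at least 3. So the cycle has
    v distinct edges, which exhaust \<open>E\<close>.\<close>
  have inj: "inj_on ?g {..<v}"
  proof (rule inj_onI)
    fix i j assume ij: "i \<in> {..<v}" "j \<in> {..<v}" and eq: "?g i = ?g j"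
    have "Suc i mod v < k" "Suc j mod v < k" using v k by auto
    then have "i = j \<or> i = Suc j mod v \<and> Suc i mod v = j"
      using eq ij k dist[of i j] dist[of i "Suc j mod v"] dist[of "Suc i mod v" j]
      by (auto simp only: doubleton_eq_iff lessThan_iff)
    then show "i = j" using v ij by (auto simp: mod_Suc split: if_splits)
  qed
  have sub: "?g ` {..<v} \<subseteq> set_mset E" using next_in k by (auto simp: NE)
  have "mset_set (set_mset E) = E"
  proof (rule multiset_eqI)
    fix e
    show "count (mset_set (set_mset E)) e = count E e"
      using simple[of e] by (cases "count E e") (auto simp: count_mset_set' simp flip: count_greater_zero_iff)
  qed
  moreover from this have "card (set_mset E) = v" using s by (metis size_mset_set)
  then have "?g ` {..<v} = set_mset E" using sub inj by (intro card_subset_eq) (auto simp: card_image)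
  ultimately have "E = image_mset ?g (mset_set {..<v})" using image_mset_mset_set[OF inj] by simp
  with bij show ?thesis by (rule that)
qed

section \<open>Optimality of the cycle\<close>

lemma degree_in_Cycle:
  assumes v: "v \<ge> 3" and i: "i < v"
  shows "degree_in (Cycle v) i = 2"
proof -
  define r where "r = (if i = 0 then v - 1 else i - 1)"
  have r: "r < v" using i v by (auto simp: r_def)
  have "degree_in (Cycle v) i = (\<Sum>j<v. count (Cycle v) {i, j})"
    by (rule degree_in_eq_sum[OF binary_design_Cycle[OF v] i])
  also have "\<dots> = (\<Sum>j<v. (if j = Suc i mod v then 1 else 0) + (if j = r then 1 else 0))"
    using v i by (intro sum.cong refl) (auto simp: count_Cycle r_def mod_Suc)
  finally show ?thesis using r v by (simp add: sum.distrib)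
qed

lemma count_Cycle_le_1:
  assumes "v \<ge> 3" "i < v" "j < v"
  shows "count (Cycle v) {i, j} \<le> 1"
  using assms by (auto simp: count_Cycle mod_Suc)

text \<open>A triangle occurs only for v = 3, where its closed 3-walks are the 6 orderings of the
  vertices.\<close>

lemma closed_3_walks_Cycle:
  fixes v :: nat
  assumes v: "v \<ge> 3"
  defines "w \<equiv> multiplicity_in (Cycle v)"
  shows "(\<Sum>i<v. \<Sum>j<v. \<Sum>k<v. w i j * w j k * w k i) \<le> (if v = 3 then 6 else 0)"
proof (cases "v = 3")
  case True
  have "w i i = 0" for i using binary_design_Cycle[OF v] by (simp add: w_def)
  moreover have "w i j * w j k * w k i \<le> 1" if "i < v" "j < v" "k < v" for i j k
    using count_Cycle_le_1[OF v] that unfolding w_def by (intro mult_le_one mult_nonneg_nonneg) auto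
  ultimately have "w i j * w j k * w k i \<le> (if i \<noteq> j \<and> j \<noteq> k \<and> k \<noteq> i then 1 else 0)" if "i < v" "j < v" "k < v" for i j k
    using that by auto
  then have "(\<Sum>i<v. \<Sum>j<v. \<Sum>k<v. w i j * w j k * w k i)
      \<le> (\<Sum>i<v. \<Sum>j<v. \<Sum>k<v. if i \<noteq> j \<and> j \<noteq> k \<and> k \<noteq> i then 1 else 0)"
    by (intro sum_mono) auto
  also have "\<dots> = 6" by (simp add: True numeral_3_eq_3 lessThan_Suc)
  finally show ?thesis using True by simp
next
  case False
  then have v4: "v \<ge> 4" using v by simp
  have "w i j * w j k * w k i = 0" if "i < v" "j < v" "k < v" for i j k
  proof (rule ccontr)
    assume "w i j * w j k * w k i \<noteq> 0"
    then have "count (Cycle v) {i, j} \<noteq> 0" "count (Cycle v) {j, k} \<noteq> 0" "count (Cycle v) {k, i} \<noteq> 0"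
      by (auto simp: w_def)
    then have "j = Suc i mod v \<or> i = Suc j mod v" "k = Suc j mod v \<or> j = Suc k mod v" "i = Suc k mod v \<or> k = Suc i mod v"
      using that v by (auto simp: count_Cycle split: if_splits)
    \<comment> \<open>Three steps of +1 or -1 add up to an odd number of absolute value at most 3,
      which is not 0 modulo v for v at least 4.\<close>
    then show False using v4 that by (auto simp: mod_Suc split: if_splits)
  qed
  then have "(\<Sum>i<v. \<Sum>j<v. \<Sum>k<v. w i j * w j k * w k i) = 0"
    by (intro sum.neutral ballI) (simp only: lessThan_iff)
  then show ?thesis using False by simp
qed

text \<open>The shift by 2 is the mean eigenvalue: the trace is the degree sum 2 v, spread over v
  eigenvalues. This is why the first moment vanishes.\<close>

lemma laplacian_spectrum:
  assumes b: "binary_design v E" and s: "size E = v" and v: "v > 0"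
  obtains es where "char_poly (laplacian v E) = (\<Prod>e\<leftarrow>es. [:- e, 1:])" "length es = v" "0 \<in> set es"
    "\<And>e. e \<in> set es \<Longrightarrow> 0 \<le> e"
    "\<And>e B. e \<in> set es \<Longrightarrow> (\<And>i. i < v \<Longrightarrow> degree_in E i \<le> B) \<Longrightarrow> e \<le> 2 * real B"
    "(\<Sum>e\<leftarrow>es. e - 2) = 0"
    "(\<Sum>e\<leftarrow>es. (e - 2)\<^sup>2) = (\<Sum>i<v. (real (degree_in E i) - 2)\<^sup>2) + (\<Sum>i<v. \<Sum>j<v. (multiplicity_in E i j)\<^sup>2)"
    "(\<Sum>e\<leftarrow>es. (e - 2) ^ 3) = (\<Sum>i<v. (real (degree_in E i) - 2) ^ 3)
        + 3 * (\<Sum>i<v. (real (degree_in E i) - 2) * (\<Sum>j<v. (multiplicity_in E i j)\<^sup>2))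
        - (\<Sum>i<v. \<Sum>j<v. \<Sum>k<v. multiplicity_in E i j * multiplicity_in E j k * multiplicity_in E k i)"
proof -
  let ?w = "multiplicity_in E"
  have L: "laplacian v E = weighted_laplacian v ?w" by (rule laplacian_eq_weighted[OF b])
  have sym: "?w i j = ?w j i" for i j by (simp add: insert_commute)
  have diag: "?w i i = 0" for i using b by simp
  have nn: "?w i j \<ge> 0" for i j by simp
  obtain es where cp: "char_poly (weighted_laplacian v ?w) = (\<Prod>e\<leftarrow>es. [:- e, 1:])" and len: "length es = v"
    by (rule weighted_laplacian_char_poly_splits[OF sym])
  have deg: "(\<Sum>j<v. ?w i j) = real (degree_in E i)" if "i < v" for i by (rule real_degree_in[OF b that])
  have "(\<Sum>i<v. real (degree_in E i)) = 2 * real v"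
    using sum_degree_in[OF b] s by (simp flip: of_nat_sum)
  then have d0: "(\<Sum>i<v. real (degree_in E i) - 2) = 0" by (simp add: sum_subtractf)
  note mom = weighted_laplacian_moments[OF sym diag cp, of 2]
  show ?thesis
  proof (rule that)
    show "char_poly (laplacian v E) = (\<Prod>e\<leftarrow>es. [:- e, 1:])" using cp by (simp add: L)
    show "0 \<in> set es" by (rule weighted_laplacian_zero_root[OF diag v cp])
    show "0 \<le> e" if "e \<in> set es" for e
      by (rule weighted_laplacian_eigenvalue_bounds(1)[OF sym diag nn cp that])
    show "e \<le> 2 * real B" if "e \<in> set es" "\<And>i. i < v \<Longrightarrow> degree_in E i \<le> B" for e B
      using that(2) by (intro weighted_laplacian_eigenvalue_bounds(2)[OF sym diag nn cp that(1)]) (simp add: deg)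
    show "(\<Sum>e\<leftarrow>es. e - 2) = 0" using mom(1) d0 by (simp add: deg)
  qed (use mom(2,3) len in \<open>simp_all add: deg\<close>)
qed

text \<open>Three cases: a double edge, a simple graph with a vertex of degree other than 2, and a
  simple 2-regular graph. The first two supply the gap required by \<open>sum_inverse_le\<close>; in
  the third the spectrum is that of the cycle. Both sums include the common term 1 / x of the
  eigenvalue 0.\<close>

lemma sum_inverse_Cycle_le:
  assumes c: "connected_design v E" and s: "size E = v" and v: "v \<ge> 3" and x: "x \<ge> real v"
    and es: "char_poly (laplacian v E) = (\<Prod>e\<leftarrow>es. [:- e, 1:])"
    and fs: "char_poly (laplacian v (Cycle v)) = (\<Prod>f\<leftarrow>fs. [:- f, 1:])"
  shows "(\<Sum>f\<leftarrow>fs. 1 / (x + f)) \<le> (\<Sum>e\<leftarrow>es. 1 / (x + e))"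
proof -
  note b = connected_design_binary[OF c] and bC = binary_design_Cycle[OF v]
  have sC: "size (Cycle v) = v" by (simp add: Cycle_def)
  have v0: "v > 0" using v by simp
  have mset_eqI: "mset xs = mset ys"
    if "(\<Prod>e\<leftarrow>xs. [:- e, 1:]) = (\<Prod>e\<leftarrow>ys. [:- e, 1:])" for xs ys :: "real list"
    using that proots_prod_linear by metis
  have sum_eq: "(\<Sum>e\<leftarrow>xs. h e) = (\<Sum>e\<leftarrow>ys. h e)" if "mset xs = mset ys" for xs ys :: "real list" and h :: "real \<Rightarrow> real"
    using that by (metis mset_map sum_mset_sum_list)
  define a where "a = x + 2"
  have a: "a \<ge> real v + 2" "a \<ge> 5" using x v by (auto simp: a_def)
  have asq: "a\<^sup>2 - 4 > 0" using a(2) power_strict_mono[of 2 a 2] by simp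
  obtain es' where es': "char_poly (laplacian v E) = (\<Prod>e\<leftarrow>es'. [:- e, 1:])" "length es' = v"
      "\<And>e. e \<in> set es' \<Longrightarrow> 0 \<le> e" "(\<Sum>e\<leftarrow>es'. e - 2) = 0"
      "((\<Sum>e\<leftarrow>es'. (e - 2)\<^sup>2) - 2 * real v) * a - (\<Sum>e\<leftarrow>es'. (e - 2) ^ 3) = spectral_gap v E a"
    by (rule laplacian_spectrum[OF b s v0]) (simp add: spectral_gap_def)
  have mE: "mset es' = mset es" using es'(1) es by (intro mset_eqI) simp
  obtain fs' where fs': "char_poly (laplacian v (Cycle v)) = (\<Prod>e\<leftarrow>fs'. [:- e, 1:])" "length fs' = v"
      "\<And>e. e \<in> set fs' \<Longrightarrow> 0 \<le> e" "\<And>e. e \<in> set fs' \<Longrightarrow> e \<le> 4" "(\<Sum>e\<leftarrow>fs'. e - 2) = 0"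
      "(\<Sum>e\<leftarrow>fs'. (e - 2)\<^sup>2) = 2 * real v" "(\<Sum>e\<leftarrow>fs'. (e - 2) ^ 3) \<ge> - (if v = 3 then 6 else 0)"
  proof (rule laplacian_spectrum[OF bC sC v0], goal_cases)
    case (1 gs)
    have sq: "(multiplicity_in (Cycle v) i j)\<^sup>2 = multiplicity_in (Cycle v) i j" if "i < v" "j < v" for i j
      using count_Cycle_le_1[OF v that] by (cases "count (Cycle v) {i, j}") auto
    have "(\<Sum>i<v. \<Sum>j<v. (multiplicity_in (Cycle v) i j)\<^sup>2) = 2 * real v"
      using v by (simp add: sq real_degree_in[OF bC] degree_in_Cycle)
    \<comment> \<open>As all degrees are 2, the third moment reduces to minus the number of closed
      3-walks, and the degree bound 2 gives eigenvalues at most 4.\<close>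
    then show ?case
      using 1(2-) closed_3_walks_Cycle[OF v] v
      by (intro 1(1)[of gs]) (auto simp: degree_in_Cycle dest: 1(6)[of _ 2])
  qed
  have mC: "mset fs' = mset fs" using fs'(1) fs by (intro mset_eqI) simp
  define F3 where "F3 = (\<Sum>e\<leftarrow>fs'. (e - 2) ^ 3)"
  have le: "(\<Sum>f\<leftarrow>fs'. 1 / (x + f)) \<le> (\<Sum>e\<leftarrow>es'. 1 / (x + e))"
    if "spectral_gap v E a * (a\<^sup>2 - 4) \<ge> 8 * real v * a - a\<^sup>2 * F3"
  proof (rule sum_inverse_le)
    show "(8 * real v * (x + 2) - (x + 2)\<^sup>2 * (\<Sum>f\<leftarrow>fs'. (f - 2) ^ 3)) / ((x + 2)\<^sup>2 - 4)
      \<le> ((\<Sum>e\<leftarrow>es'. (e - 2)\<^sup>2) - 2 * real v) * (x + 2) - (\<Sum>e\<leftarrow>es'. (e - 2) ^ 3)"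
      using that asq es'(5) unfolding F3_def a_def by (simp add: pos_divide_le_eq)
  qed (use es' fs' x v in auto)
  have va: "8 * real v * a \<le> 8 * (a - 2) * a" using a by (intro mult_right_mono) auto
  have "(\<Sum>f\<leftarrow>fs'. 1 / (x + f)) \<le> (\<Sum>e\<leftarrow>es'. 1 / (x + e))"
  proof (cases "\<exists>e0. count E e0 \<ge> 2")
    case True
    then obtain e0 where "count E e0 \<ge> 2" by blast
    from spectral_gap_double_edge[OF c s v a(1) this] have gap: "spectral_gap v E a \<ge> 15" .
    have "15 * (a\<^sup>2 - 4) \<le> spectral_gap v E a * (a\<^sup>2 - 4)"
      using gap asq by (intro mult_right_mono) auto
    moreover have "8 * real v * a - a\<^sup>2 * F3 \<le> 15 * (a\<^sup>2 - 4)"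
    proof (cases "v = 3")
      case True
      then have "a\<^sup>2 * - F3 \<le> a\<^sup>2 * 6" using fs'(7) by (intro mult_left_mono) (auto simp: F3_def)
      \<comment> \<open>For v = 3 the goal follows from 24 a + 6 a^2 \<le> 15 (a^2 - 4). The product
        equals 9 a^2 - 24 a - 105, which leaves 45 to spare.\<close>
      moreover have "0 \<le> (a - 5) * (9 * a + 21)" using a(2) by (intro mult_nonneg_nonneg) auto
      ultimately show ?thesis using True by (simp add: power2_eq_square algebra_simps)
    next
      case False
      then have "a\<^sup>2 * - F3 \<le> a\<^sup>2 * 0" using fs'(7) by (intro mult_left_mono) (auto simp: F3_def)
      moreover have "0 \<le> (a - 5) * (7 * a + 51)" using a(2) by (intro mult_nonneg_nonneg) auto
      ultimately show ?thesis using va a(2) by (simp add: power2_eq_square algebra_simps)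
    qed
    ultimately show ?thesis by (intro le) linarith
  next
    case False
    have simple: "count E e \<le> 1" for e
    proof -
      have "\<not> 2 \<le> count E e" using False by blast
      then show ?thesis by simp
    qed
    show ?thesis
    proof (cases "\<exists>i<v. degree_in E i \<noteq> 2")
      case True
      then obtain i0 where "i0 < v" "degree_in E i0 \<noteq> 2" by blast
      from spectral_gap_simple[OF c s v a(1) simple this]
      have v4: "v \<ge> 4" and gap: "spectral_gap v E a \<ge> 2 * (a - 3)" by auto
      have a6: "a \<ge> 6" using a v4 by simp
      have "2 * (a - 3) * (a\<^sup>2 - 4) \<le> spectral_gap v E a * (a\<^sup>2 - 4)"
        using gap asq by (intro mult_right_mono) auto
      moreover have "a\<^sup>2 * - F3 \<le> a\<^sup>2 * 0"
        using fs'(7) v4 by (intro mult_left_mono) (auto simp: F3_def)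
      moreover have "8 * (a - 2) * a \<le> 2 * (a - 3) * (a\<^sup>2 - 4)"
      proof -
        \<comment> \<open>The exact difference of the two sides. It is zero at a = 6, that is for v
          = 4 and x = 4, so the bound \<open>v \<ge> 4\<close> is used in full.\<close>
        have "0 \<le> 2 * (a - 2) * ((a - 6) * (a + 1))" using a6 by (intro mult_nonneg_nonneg) auto
        then show ?thesis by (simp add: power2_eq_square algebra_simps)
      qed
      ultimately show ?thesis using va by (intro le) simp
    next
      case False
      then obtain f where "bij_betw f {..<v} {..<v}" "E = image_mset (\<lambda>k. {f k, f (Suc k mod v)}) (mset_set {..<v})"
        using regular_simple_connected_is_cycle[OF c s v simple] by blast
      from char_poly_laplacian_relabelled_cycle[OF v this(1) b this(2)]
      have "mset fs' = mset es'" using es'(1) fs'(1) by (intro mset_eqI) simp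
      then show ?thesis using sum_eq by (metis order_refl)
    qed
  qed
  then show ?thesis using sum_eq[OF mE] sum_eq[OF mC] by metis
qed

section \<open>From sums over the spectrum to the two criteria\<close>

lemma connected_design_Cycle:
  assumes v: "v \<ge> 3"
  shows "connected_design v (Cycle v)"
proof -
  let ?R = "{(a, b). {a, b} \<in># Cycle v}"
  have up: "(0, i) \<in> ?R\<^sup>*" if "i < v" for i
    using that
  proof (induction i)
    case (Suc i)
    then have "(i, Suc i) \<in> ?R" by (auto simp: Cycle_def intro!: image_eqI[of _ _ i])
    with Suc show ?case by (auto intro: rtrancl_into_rtrancl)
  qed simp
  have "sym ?R" by (auto simp: sym_def insert_commute)
  then have "sym (?R\<^sup>*)" by (rule sym_rtrancl)
  then have "(i, j) \<in> ?R\<^sup>*" if "i < v" "j < v" for i j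
    using up[OF that(1)] up[OF that(2)] by (meson rtrancl_trans symD)
  then show ?thesis using binary_design_Cycle[OF v] by (simp add: connected_design_def)
qed

lemma laplacian_Cycle_in_laplacians: "v \<ge> 3 \<Longrightarrow> laplacian v (Cycle v) \<in> laplacians v v"
  unfolding laplacians_def using connected_design_Cycle by (auto simp: Cycle_def intro!: exI[of _ "Cycle v"])

lemma sum_list_pos:
  fixes h :: "'a \<Rightarrow> real"
  assumes "length xs > 0" "\<And>x. x \<in> set xs \<Longrightarrow> h x > 0"
  shows "(\<Sum>x\<leftarrow>xs. h x) > 0"
  using assms
proof (induction xs)
  case (Cons x xs)
  then show ?case by (cases xs) (auto intro!: add_pos_pos)
qed simp

text \<open>The split-off part \<open>h 0\<close> is the same for all graphs, so comparisons over
  full spectra pass to the nontrivial eigenvalues.\<close>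

lemma sum_prod_nontrivial_eigenvalues:
  assumes "char_poly L = (\<Prod>e\<leftarrow>es. [:- e, 1:])" "0 \<in> set es"
  shows "(\<Sum>e\<leftarrow>es. h e) = h 0 + (\<Sum>e\<in>#nontrivial_eigenvalues L. h e)"
    and "(\<Prod>e\<leftarrow>es. h e) = h 0 * (\<Prod>e\<in>#nontrivial_eigenvalues L. h e)"
proof -
  have "mset es = add_mset 0 (nontrivial_eigenvalues L)"
    using assms by (simp add: nontrivial_eigenvalues_def proots_prod_linear)
  then have m: "mset (map h es) = add_mset (h 0) (image_mset h (nontrivial_eigenvalues L))"
    by simp
  show "(\<Sum>e\<leftarrow>es. h e) = h 0 + (\<Sum>e\<in>#nontrivial_eigenvalues L. h e)"
    unfolding sum_mset_sum_list[symmetric] m by simp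
  show "(\<Prod>e\<leftarrow>es. h e) = h 0 * (\<Prod>e\<in>#nontrivial_eigenvalues L. h e)"
    unfolding prod_mset_prod_list[symmetric] m by simp
qed

lemma criteria_le_Cycle:
  assumes c: "connected_design v E" and s: "size E = v" and v: "v \<ge> 3" and y: "y \<ge> 1"
  shows "A_value v y (laplacian v E) \<le> A_value v y (laplacian v (Cycle v))"
    and "D_value v y (laplacian v E) \<le> D_value v y (laplacian v (Cycle v))"
proof -
  note b = connected_design_binary[OF c] and bC = binary_design_Cycle[OF v]
  have sC: "size (Cycle v) = v" by (simp add: Cycle_def)
  have v0: "v > 0" using v by simp
  define x where "x = real v * real y"
  have xv: "x \<ge> real v" using mult_left_mono[of 1 "real y" "real v"] y by (simp add: x_def)
  then have x0: "x > 0" using v by simp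
  obtain es where es: "char_poly (laplacian v E) = (\<Prod>e\<leftarrow>es. [:- e, 1:])" "length es = v" "0 \<in> set es"
      "\<And>e. e \<in> set es \<Longrightarrow> 0 \<le> e"
    by (rule laplacian_spectrum[OF b s v0]) simp
  obtain fs where fs: "char_poly (laplacian v (Cycle v)) = (\<Prod>e\<leftarrow>fs. [:- e, 1:])" "length fs = v" "0 \<in> set fs"
      "\<And>e. e \<in> set fs \<Longrightarrow> 0 \<le> e"
    by (rule laplacian_spectrum[OF bC sC v0]) simp
  note nE = sum_prod_nontrivial_eigenvalues[OF es(1,3)] and nC = sum_prod_nontrivial_eigenvalues[OF fs(1,3)]
  let ?SE = "\<Sum>\<rho>\<in>#nontrivial_eigenvalues (laplacian v E). 1 / (x + \<rho>)"
  let ?SC = "\<Sum>\<rho>\<in>#nontrivial_eigenvalues (laplacian v (Cycle v)). 1 / (x + \<rho>)"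
  have "?SC \<le> ?SE"
    using sum_inverse_Cycle_le[OF c s v xv es(1) fs(1)] by (simp add: nE(1) nC(1))
  \<comment> \<open>Taking reciprocals reverses the inequality only for positive sums; v at least 3
    leaves a nontrivial eigenvalue to sum over.\<close>
  moreover have "?SC > 0"
  proof -
    have "nontrivial_eigenvalues (laplacian v (Cycle v)) = mset (remove1 0 fs)"
      using fs(1) by (simp add: nontrivial_eigenvalues_def proots_prod_linear)
    then have eq: "?SC = (\<Sum>f\<leftarrow>remove1 0 fs. 1 / (x + f))"
      by (metis mset_map sum_mset_sum_list)
    have "length (remove1 0 fs) > 0" using fs(2,3) v by (simp add: length_remove1)
    moreover have "1 / (x + f) > 0" if "f \<in> set (remove1 0 fs)" for f
      using fs(4)[of f] that x0 set_remove1_subset[of 0 fs] by (auto intro!: divide_pos_pos add_pos_nonneg)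
    ultimately show ?thesis unfolding eq by (intro sum_list_pos)
  qed
  ultimately show "A_value v y (laplacian v E) \<le> A_value v y (laplacian v (Cycle v))"
    unfolding A_value_def x_def[symmetric] using v by (intro divide_left_mono mult_pos_pos) auto
  \<comment> \<open>The inequality between the sums holds at every real point from \<open>x\<close>
    on, as the integration requires. The factor \<open>x\<close> of the eigenvalue 0 is positive and
    cancels afterwards.\<close>
  have "(\<Prod>e\<leftarrow>es. x + e) \<le> (\<Prod>f\<leftarrow>fs. x + f)"
  proof (rule prod_le_if_sum_inverse_le[OF x0])
    show "(\<Sum>f\<leftarrow>fs. 1 / (u + f)) \<le> (\<Sum>e\<leftarrow>es. 1 / (u + e))" if "u \<ge> x" for u
      using that xv by (intro sum_inverse_Cycle_le[OF c s v _ es(1) fs(1)]) simp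
  qed (use es fs in auto)
  then show "D_value v y (laplacian v E) \<le> D_value v y (laplacian v (Cycle v))"
    unfolding D_value_def x_def[symmetric] using x0 by (simp add: nE(2) nC(2))
qed

theorem proposition3p2:
  fixes v :: nat
  assumes "v \<ge> 3"
  shows "(\<forall>y\<ge>0. \<forall>E. connected_design v E \<and>
              laplacian v E = augment v y (laplacian v (Cycle v)) \<longrightarrow> D_optimal v v y E) \<and>
         (\<forall>y\<ge>1. \<forall>E. connected_design v E \<and>
              laplacian v E = augment v y (laplacian v (Cycle v)) \<longrightarrow> A_optimal v v y E) \<and>
         (\<forall>y\<ge>0. \<forall>L\<in>laplacians v v. D_value v y (laplacian v (Cycle v)) \<ge> D_value v y L) \<and>
         (\<forall>y\<ge>1. \<forall>L\<in>laplacians v v. A_value v y (laplacian v (Cycle v)) \<ge> A_value v y L)"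
proof -
  have A: "A_value v y L \<le> A_value v y (laplacian v (Cycle v))" if "y \<ge> 1" "L \<in> laplacians v v" for y L
    using that criteria_le_Cycle(1)[OF _ _ assms] by (auto simp: laplacians_def)
  \<comment> \<open>The comparison of sums requires x to be at least v, so y = 0 is settled by the
    determinant bound instead.\<close>
  have D: "D_value v y L \<le> D_value v y (laplacian v (Cycle v))" if L: "L \<in> laplacians v v" for y L
  proof (cases "y = 0")
    case True
    obtain E where E: "L = laplacian v E" "connected_design v E" "size E = v"
      using L by (auto simp: laplacians_def)
    then have "D_value v 0 L \<le> (real v)\<^sup>2"
      using D_value_zero_le[OF connected_design_binary] assms by simp
    then show ?thesis using D_value_zero_Cycle[OF assms] True by simp
  next
    case False
    then show ?thesis using L criteria_le_Cycle(2)[OF _ _ assms, of _ y] by (auto simp: laplacians_def)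
  qed
  note C = laplacian_Cycle_in_laplacians[OF assms]
  \<comment> \<open>The Laplacian of the cycle is the witness for \<open>L\<close> in
    \<open>optimal_among\<close>.\<close>
  have "D_optimal v v y E" if "connected_design v E" "laplacian v E = augment v y (laplacian v (Cycle v))" for y E
    unfolding D_optimal_def optimal_among_def using that C D by blast
  moreover have "A_optimal v v y E"
    if "y \<ge> 1" "connected_design v E" "laplacian v E = augment v y (laplacian v (Cycle v))" for y E
    unfolding A_optimal_def optimal_among_def using that C A by blast
  ultimately show ?thesis using A D by blast
qed

end
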